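(* Let $b>0$, $a>0$, $\mu>-1$ and $\nu>\max\{-b,-a\mu\}$, and consider the kernel, for $0<s<t$, $$k(t,s):=\frac{a}{\Gamma(b/a)}(t^a-s^a)^{\frac ba-1}t^{a-\nu}s^{\nu-1}F_3\Big(\frac\nu a-1,\frac ba,1,\mu,\frac ba,1-\big(\tfrac st\big)^a,1-\big(\tfrac ts\big)^a\Big).$$ Then $k$ is homogeneous of degree $b-1$ (i.e. $k(t,ts)=t^{b-1}k(1,s)$ for $t>0$, $s\in(0,1)$) and $k(1,\cdot)\in L^{1+\varepsilon}((0,1))$ for some $\varepsilon>0$. Moreover, the function $\hat\Phi(z)=\sum_{n\ge0}\hat c_nz^n$ defined by $\hat c_0=1$, $\hat c_n=\hat c_{n-1}\int_0^1k(1,s)s^{b(n-1)}ds$ ($n\in\mathbb{N}$) is given by $$\hat\Phi(z)=\Gamma(\lambda_2)E^{\lambda_3}_{\lambda_1,\lambda_2}(z),\qquad z\in\mathbb{C},$$ where $\lambda_1=\frac ba$, $\lambda_2=\frac\nu a+\mu$, $\lambda_3=1+\frac{\nu-a}{b}$.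
   Context: Appell's third function is $F_3(\alpha,\alpha',\beta,\beta',\gamma,x,y)=\sum_{m,n\ge0}\frac{(\alpha)_m(\beta)_m(\alpha')_n(\beta')_n}{(\gamma)_{m+n}\,n!\,m!}x^my^n$ for $\gamma\notin-\mathbb{N}$, convergent for $|x|,|y|<1$ and analytically extended to real $x,y<1$; here $(\lambda)_0=1$ and $(\lambda)_n=\lambda(\lambda+1)\cdots(\lambda+n-1)$ is the Pochhammer symbol. The three-parameter (Prabhakar) Mittag-Leffler function is $E^{\lambda_3}_{\lambda_1,\lambda_2}(z)=\sum_{n=0}^\infty\frac{(\lambda_3)_n}{\Gamma(\lambda_1n+\lambda_2)\,n!}z^n$, entire for $\mathrm{Re}\,\lambda_1>0$. *)

theory Defs
  imports "HOL-Analysis.Analysis"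
begin

definition appell_F3_term ::
  "real \<Rightarrow> real \<Rightarrow> real \<Rightarrow> real \<Rightarrow> real \<Rightarrow> real \<Rightarrow> real \<Rightarrow> nat \<times> nat \<Rightarrow> real" where
  "appell_F3_term \<alpha> \<alpha>' \<beta> \<beta>' \<gamma> x y = (\<lambda>(m, n).
     pochhammer \<alpha> m * pochhammer \<beta> m * pochhammer \<alpha>' n * pochhammer \<beta>' n
     / (pochhammer \<gamma> (m + n) * fact n * fact m) * x ^ m * y ^ n)"

text \<open>The double series (meaningful for |x|, |y| < 1).\<close>
definition appell_F3_series ::
  "real \<Rightarrow> real \<Rightarrow> real \<Rightarrow> real \<Rightarrow> real \<Rightarrow> real \<Rightarrow> real \<Rightarrow> real" where
  "appell_F3_series \<alpha> \<alpha>' \<beta> \<beta>' \<gamma> x y = infsum (appell_F3_term \<alpha> \<alpha>' \<beta> \<beta>' \<gamma> x y) UNIV"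

definition real_analytic_on2 :: "(real \<times> real \<Rightarrow> real) \<Rightarrow> (real \<times> real) set \<Rightarrow> bool" where
  "real_analytic_on2 G S \<longleftrightarrow>
     (\<forall>p\<in>S. \<exists>r>0. \<exists>c :: nat \<Rightarrow> nat \<Rightarrow> real. \<forall>x y.
        \<bar>x - fst p\<bar> < r \<and> \<bar>y - snd p\<bar> < r \<longrightarrow>
        ((\<lambda>(m, n). c m n * (x - fst p) ^ m * (y - snd p) ^ n) has_sum G (x, y)) UNIV)"

text \<open>Appell's F3, analytically extended to real x, y < 1: the (unique) real-analytic function
  on {x<1, y<1} agreeing with the double series on the square |x|,|y|<1.\<close>
definition appell_F3 ::
  "real \<Rightarrow> real \<Rightarrow> real \<Rightarrow> real \<Rightarrow> real \<Rightarrow> real \<Rightarrow> real \<Rightarrow> real" where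
  "appell_F3 \<alpha> \<alpha>' \<beta> \<beta>' \<gamma> x y =
     (SOME G. real_analytic_on2 G {p. fst p < 1 \<and> snd p < 1} \<and>
        (\<forall>u v. \<bar>u\<bar> < 1 \<and> \<bar>v\<bar> < 1 \<longrightarrow> G (u, v) = appell_F3_series \<alpha> \<alpha>' \<beta> \<beta>' \<gamma> u v)) (x, y)"

definition mittag_leffler3 :: "complex \<Rightarrow> complex \<Rightarrow> complex \<Rightarrow> complex \<Rightarrow> complex" where
  "mittag_leffler3 l1 l2 l3 z =
     (\<Sum>n. pochhammer l3 n / (Gamma (l1 * of_nat n + l2) * fact n) * z ^ n)"

definition kernel_k :: "real \<Rightarrow> real \<Rightarrow> real \<Rightarrow> real \<Rightarrow> real \<Rightarrow> real \<Rightarrow> real" where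
  "kernel_k a b \<mu> \<nu> t s =
     a / Gamma (b / a) * (t powr a - s powr a) powr (b / a - 1) * t powr (a - \<nu>) * s powr (\<nu> - 1)
     * appell_F3 (\<nu> / a - 1) (b / a) 1 \<mu> (b / a) (1 - (s / t) powr a) (1 - (t / s) powr a)"

end

theory Submission
  imports Defs "HOL-Complex_Analysis.Conformal_Mappings" "HOL-Real_Asymp.Real_Asymp"
begin

text \<open>
  Write \<open>p = \<nu> / a\<close>, \<open>q = b / a\<close> and \<open>e = p + \<mu>\<close>. Since \<open>\<alpha>' = \<gamma> = q\<close> and \<open>\<beta> = 1\<close>, the coefficient
  \<open>(q)\<^sub>n / (q)\<^sub>m\<^sub>+\<^sub>n\<close> is a Beta integral for \<open>m \<ge> 1\<close>; summing the two binomial series under this integral,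
  the analytic extension of \<open>F\<^sub>3\<close> to \<open>x, y < 1\<close> is
  \<open>(1 - y)\<^bsup>-\<mu>\<^esup> + (p - 1) x \<integral>\<^sub>0\<^sup>1 u\<^bsup>q-1\<^esup> (1 - u y)\<^bsup>-\<mu>\<^esup> (1 - (1 - u) x)\<^bsup>-p\<^esup> du\<close>.
  It is the only one, by the one-variable identity theorem applied first to horizontal and then to
  vertical slices.

  At \<open>x = 1 - \<sigma>\<close>, \<open>y = 1 - 1 / \<sigma>\<close> both bases reduce to \<open>w = u + \<sigma> (1 - u)\<close>, up to a factor \<open>\<sigma>\<close>. With
  \<open>\<sigma> = s\<^sup>a\<close>, Tonelli's theorem in the variables \<open>\<sigma> < w\<close> gives the moments
  \<open>\<Gamma>(A) / \<Gamma>(A + q) \<cdot> (1 + (p - 1) / (q (n + 1)))\<close>, \<open>A = e + q n\<close>, which are the coefficient ratios of the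
  Mittag-Leffler series. Integrability of a power of the kernel beyond the first follows from
  \<open>w\<^bsup>-e\<^esup> \<le> \<sigma>\<^bsup>\<delta>-e\<^esup> u\<^bsup>-\<delta>\<^esup>\<close> for small \<open>\<delta> > 0\<close>.
\<close>

section \<open>Termwise integration and binomial series\<close>

text \<open>Outside a finite \<open>Y\<close> the terms add up to at most the tail
  \<open>a - sum A Y\<close> times \<open>w\<close>; this bound can be integrated and vanishes along
  the net of finite index sets.\<close>

lemma has_sum_integral_dominated:
  fixes f :: "'i \<Rightarrow> 'a \<Rightarrow> real"
  assumes f: "\<And>i. integrable M (f i)" and S: "integrable M S" and w: "integrable M w"
    and A: "A summable_on UNIV"
    and bound: "\<And>i x. \<bar>f i x\<bar> \<le> A i * w x"
    and sum: "\<And>x. ((\<lambda>i. f i x) has_sum S x) UNIV"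
  shows "((\<lambda>i. integral\<^sup>L M (f i)) has_sum integral\<^sup>L M S) UNIV"
proof -
  obtain a where a: "(A has_sum a) UNIV"
    using A by (auto simp: summable_on_def)
  have key: "\<bar>sum (\<lambda>i. integral\<^sup>L M (f i)) Y - integral\<^sup>L M S\<bar> \<le> (a - sum A Y) * integral\<^sup>L M w"
    if Y: "finite Y" for Y
  proof -
    have pt: "\<bar>S x - (\<Sum>i\<in>Y. f i x)\<bar> \<le> (a - sum A Y) * w x" for x
    proof -
      have 1: "((\<lambda>i. f i x) has_sum (S x - (\<Sum>i\<in>Y. f i x))) (UNIV - Y)"
        using Y by (intro has_sum_Diff sum has_sum_finite) auto
      have 2: "((\<lambda>i. A i * w x) has_sum ((a - sum A Y) * w x)) (UNIV - Y)"
        using Y by (intro has_sum_cmult_left has_sum_Diff a has_sum_finite) auto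
      \<comment> \<open>Comparing both \<open>f\<close> and \<open>- f\<close> with the majorant
        yields the bound on the absolute value.\<close>
      have 3: "((\<lambda>i. - f i x) has_sum (- (S x - (\<Sum>i\<in>Y. f i x)))) (UNIV - Y)"
        using 1 by (simp only: has_sum_uminus minus_minus)
      have le1: "f i x \<le> A i * w x" and le2: "- f i x \<le> A i * w x" for i
        using bound[of i x] by linarith+
      show ?thesis
        using has_sum_mono[OF 1 2 le1] has_sum_mono[OF 3 2 le2] by linarith
    qed
    have "sum (\<lambda>i. integral\<^sup>L M (f i)) Y - integral\<^sup>L M S
        = - (LINT x|M. S x - (\<Sum>i\<in>Y. f i x))"
      using f S by simp
    also have "\<bar>\<dots>\<bar> \<le> (LINT x|M. \<bar>S x - (\<Sum>i\<in>Y. f i x)\<bar>)"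
      by simp
    also have "\<dots> \<le> (LINT x|M. (a - sum A Y) * w x)"
      using f S w pt by (intro integral_mono) auto
    finally show ?thesis by simp
  qed
  have "((\<lambda>Y. (a - sum A Y) * integral\<^sup>L M w) \<longlongrightarrow> (a - a) * integral\<^sup>L M w) (finite_subsets_at_top UNIV)"
    using a unfolding has_sum_def by (intro tendsto_intros)
  then have lim: "((\<lambda>Y. (a - sum A Y) * integral\<^sup>L M w) \<longlongrightarrow> 0) (finite_subsets_at_top UNIV)"
    by simp
  have "((\<lambda>Y. sum (\<lambda>i. integral\<^sup>L M (f i)) Y - integral\<^sup>L M S) \<longlongrightarrow> 0) (finite_subsets_at_top UNIV)"
    by (rule Lim_null_comparison[OF _ lim]) (auto intro!: eventually_finite_subsets_at_top_weakI key)
  then show ?thesis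
    unfolding has_sum_def by (simp add: LIM_zero_iff)
qed

text \<open>Unordered real sums converge absolutely, so the product family is summable over pairs
  and may be evaluated row by row.\<close>

lemma has_sum_times:
  fixes f :: "'a \<Rightarrow> real" and g :: "'b \<Rightarrow> real"
  assumes "(f has_sum x) UNIV" "(g has_sum y) UNIV"
  shows "((\<lambda>(i, j). f i * g j) has_sum (x * y)) UNIV"
proof -
  have f: "(\<lambda>i. \<bar>f i\<bar>) summable_on UNIV" and g: "(\<lambda>j. \<bar>g j\<bar>) summable_on UNIV"
    using assms summable_on_iff_abs_summable_on_real[of f UNIV] summable_on_iff_abs_summable_on_real[of g UNIV]
    by (auto simp: summable_on_def)
  obtain Y where Y: "((\<lambda>j. \<bar>g j\<bar>) has_sum Y) UNIV" using g by (auto simp: summable_on_def)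
  have "(\<lambda>(i, j). \<bar>f i\<bar> * \<bar>g j\<bar>) summable_on UNIV \<times> UNIV"
    by (rule summable_on_SigmaI[where g = "\<lambda>i. \<bar>f i\<bar> * Y"])
       (auto intro: has_sum_cmult_right[OF Y] summable_on_cmult_left[OF f])
  then have "(\<lambda>(i, j). f i * g j) summable_on UNIV \<times> UNIV"
    by (subst summable_on_iff_abs_summable_on_real) (simp add: case_prod_unfold abs_mult)
  moreover have "((\<lambda>i. f i * y) has_sum (x * y)) UNIV"
    by (intro has_sum_cmult_left assms)
  ultimately have "((\<lambda>(i, j). f i * g j) has_sum (x * y)) (UNIV \<times> UNIV)"
    by (intro has_sum_SigmaI[where g = "\<lambda>i. f i * y"]) (auto intro: has_sum_cmult_right assms)
  then show ?thesis by simp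
qed

lemma binomial_series_pochhammer:
  fixes a z :: real
  assumes "\<bar>z\<bar> < 1"
  shows "((\<lambda>n. pochhammer a n / fact n * z ^ n) has_sum (1 - z) powr (- a)) UNIV"
    and "(\<lambda>n. \<bar>pochhammer a n / fact n\<bar> * \<bar>z\<bar> ^ n) summable_on UNIV"
proof -
  have sums: "(\<lambda>n. pochhammer a n / fact n * x ^ n) sums (1 - x) powr (- a)" if "\<bar>x\<bar> < 1" for x
  proof -
    have "((- a) gchoose n) * (- x) ^ n = pochhammer a n / fact n * x ^ n" for n
    proof -
      have "((- a) gchoose n) * (- x) ^ n = ((-1) ^ n * (-1) ^ n) * (pochhammer a n / fact n * x ^ n)"
        by (simp only: gbinomial_pochhammer power_minus[of x] minus_minus) simp
      then show ?thesis by (simp flip: power_mult_distrib)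
    qed
    then show ?thesis
      using gen_binomial_real[of "- x" "- a"] that by simp
  qed
  \<comment> \<open>Absolute convergence, which unordered summation requires, follows from
    convergence at a point \<open>x\<close> strictly between \<open>\<bar>z\<bar>\<close> and
    1.\<close>
  obtain x :: real where x: "\<bar>z\<bar> < x" "x < 1" using assms dense by blast
  have *: "summable (\<lambda>n. norm (pochhammer a n / fact n * z ^ n))"
    using x by (intro powser_insidea[OF sums_summable[OF sums[of x]]]) auto
  show "((\<lambda>n. pochhammer a n / fact n * z ^ n) has_sum (1 - z) powr (- a)) UNIV"
    by (rule norm_summable_imp_has_sum[OF * sums[OF assms]])
  show "(\<lambda>n. \<bar>pochhammer a n / fact n\<bar> * \<bar>z\<bar> ^ n) summable_on UNIV"
    using * by (intro summable_nonneg_imp_summable_on) (auto simp: abs_mult power_abs)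
qed

lemma one_minus_mult_pos:
  fixes v x :: real
  assumes "0 \<le> v" "v \<le> 1" "x < 1"
  shows "1 - v * x > 0"
proof -
  have "v * x < 1"
  proof (cases "x \<ge> 0")
    case True
    then show ?thesis using assms mult_right_mono[of v 1 x] by simp
  next
    case False
    then show ?thesis using assms mult_nonneg_nonpos[of v x] by simp
  qed
  then show ?thesis by simp
qed

text \<open>The quotient \<open>v / (1 - v * x0)\<close> increases with \<open>v\<close>, so
  \<open>v = 1\<close> is the worst case. The resulting ratio is free of \<open>v\<close>, as a
  majorant under the integral must be.\<close>

lemma shifted_ratio_bound:
  fixes v x0 x :: real
  assumes "0 \<le> v" "v \<le> 1" "x0 < 1"
  shows "\<bar>v / (1 - v * x0)\<bar> * \<bar>x - x0\<bar> \<le> \<bar>x - x0\<bar> / (1 - x0)"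
proof -
  have "v / (1 - v * x0) \<le> 1 / (1 - x0)"
    using assms one_minus_mult_pos[OF assms] by (simp add: field_simps)
  moreover have "v / (1 - v * x0) \<ge> 0"
    using assms one_minus_mult_pos[OF assms] by simp
  ultimately have "\<bar>v / (1 - v * x0)\<bar> * \<bar>x - x0\<bar> \<le> (1 / (1 - x0)) * \<bar>x - x0\<bar>"
    by (intro mult_right_mono) (auto simp only: abs_of_nonneg)
  then show ?thesis by simp
qed

text \<open>Recentring rests on \<open>1 - v * x = (1 - ?z) * (1 - v * x0)\<close>: the first factor
  is expanded by the binomial series, the second does not depend on \<open>x\<close>.\<close>

lemma binomial_series_shifted:
  fixes p v x0 x :: real
  assumes v: "0 \<le> v" "v \<le> 1" and x0: "x0 < 1" and x: "\<bar>x - x0\<bar> < 1 - x0"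
  shows "((\<lambda>m. pochhammer p m / fact m * (v / (1 - v * x0)) ^ m * (x - x0) ^ m * (1 - v * x0) powr (- p))
           has_sum (1 - v * x) powr (- p)) UNIV"
proof -
  let ?z = "v / (1 - v * x0) * (x - x0)"
  have pos: "1 - v * x0 > 0" "1 - v * x > 0"
    using one_minus_mult_pos v x0 x by auto
  have "\<bar>?z\<bar> \<le> \<bar>x - x0\<bar> / (1 - x0)"
    using shifted_ratio_bound[OF v x0] by (simp only: abs_mult)
  also have "\<dots> < 1" using x x0 by simp
  finally have z: "\<bar>?z\<bar> < 1" .
  have *: "(1 - ?z) * (1 - v * x0) = 1 - v * x"
    using pos by (simp add: field_simps)
  have "(1 - ?z) powr (- p) * (1 - v * x0) powr (- p) = (1 - v * x) powr (- p)"
    using z pos by (subst powr_mult[symmetric]) (auto simp only: * abs_less_iff)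
  with has_sum_cmult_left[OF binomial_series_pochhammer(1)[OF z], of p "(1 - v * x0) powr (- p)"]
  show ?thesis by (simp only: power_mult_distrib mult.assoc)
qed

section \<open>The analytic extension of \<open>F\<^sub>3\<close>\<close>

lemma nn_integral_Beta:
  fixes \<alpha> \<beta> :: real
  assumes "\<alpha> > 0" "\<beta> > 0"
  shows "(\<integral>\<^sup>+u. ennreal (indicator {0<..<1} u * (u powr (\<alpha> - 1) * (1 - u) powr (\<beta> - 1))) \<partial>lborel)
           = ennreal (Beta \<alpha> \<beta>)"
proof -
  have "((\<lambda>u. u powr (\<alpha> - 1) * (1 - u) powr (\<beta> - 1)) has_integral Beta \<alpha> \<beta>) {0<..<1}"
    using has_integral_Beta_real[OF assms] by (simp add: has_integral_Icc_iff_Ioo)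
  then have "((\<lambda>u. indicator {0<..<1} u * (u powr (\<alpha> - 1) * (1 - u) powr (\<beta> - 1))) has_integral Beta \<alpha> \<beta>) UNIV"
    by (subst (asm) has_integral_restrict_UNIV[symmetric])
       (auto elim!: back_subst[of "\<lambda>f. (f has_integral _) _"] simp: fun_eq_iff)
  then show ?thesis
    by (intro nn_integral_has_integral_lborel) auto
qed

lemma
  fixes \<alpha> \<beta> :: real
  assumes "\<alpha> > 0" "\<beta> > 0"
  shows set_integrable_Beta: "set_integrable lborel {0<..<1} (\<lambda>u. u powr (\<alpha> - 1) * (1 - u) powr (\<beta> - 1))"
    and LBINT_Beta: "(LBINT u:{0<..<1}. u powr (\<alpha> - 1) * (1 - u) powr (\<beta> - 1)) = Beta \<alpha> \<beta>"
proof -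
  have "has_bochner_integral lborel (\<lambda>u. indicator {0<..<1} u * (u powr (\<alpha> - 1) * (1 - u) powr (\<beta> - 1))) (Beta \<alpha> \<beta>)"
    using nn_integral_Beta[OF assms] assms
    by (intro has_bochner_integral_nn_integral) (auto simp: Beta_def)
  then show "set_integrable lborel {0<..<1} (\<lambda>u. u powr (\<alpha> - 1) * (1 - u) powr (\<beta> - 1))"
    and "(LBINT u:{0<..<1}. u powr (\<alpha> - 1) * (1 - u) powr (\<beta> - 1)) = Beta \<alpha> \<beta>"
    by (auto simp: set_integrable_def set_lebesgue_integral_def has_bochner_integral_iff)
qed

lemma set_integrable_powr_01:
  assumes "q > (0::real)"
  shows "set_integrable lborel {0<..<1} (\<lambda>u. u powr (q - 1))"
proof -
  have "set_integrable lborel {0<..<1} (\<lambda>u. u powr (q - 1) * (1 - u) powr (1 - 1))"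
    using assms by (intro set_integrable_Beta) auto
  then show ?thesis
    by (rule set_integrable_cong[THEN iffD1, rotated -1]) auto
qed

section \<open>The integral part of the extension and its double power series\<close>

definition F3_weight :: "real \<Rightarrow> real \<Rightarrow> real \<Rightarrow> real \<Rightarrow> real \<Rightarrow> real \<Rightarrow> real" where
  "F3_weight p q \<mu> x y u = u powr (q - 1) * (1 - u * y) powr (- \<mu>) * (1 - (1 - u) * x) powr (- p)"

lemma F3_weight_measurable [measurable]: "F3_weight p q \<mu> x y \<in> borel_measurable borel"
  unfolding F3_weight_def by measurable

lemma F3_weight_nonneg: "F3_weight p q \<mu> x y u \<ge> 0"
  by (simp add: F3_weight_def)

text \<open>On \<open>[0, 1]\<close> the last two factors are continuous, their bases being
  positive, hence bounded; what remains is \<open>u powr (q - 1)\<close>.\<close>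

lemma set_integrable_F3_weight:
  assumes "q > 0" "x < 1" "y < 1"
  shows "set_integrable lborel {0<..<1} (F3_weight p q \<mu> x y)"
proof -
  let ?h = "\<lambda>u. (1 - u * y) powr (- \<mu>) * (1 - (1 - u) * x) powr (- p)"
  have pos: "1 - u * y > 0" "1 - (1 - u) * x > 0" if "u \<in> {0..1}" for u
    using that assms one_minus_mult_pos[of u y] one_minus_mult_pos[of "1 - u" x] by auto
  have "continuous_on {0..1} ?h"
    using pos by (intro continuous_intros) (auto simp: less_le)
  then have "bounded (?h ` {0..1})"
    by (intro compact_imp_bounded compact_continuous_image) auto
  then obtain C where C: "\<And>u. u \<in> {0..1} \<Longrightarrow> \<bar>?h u\<bar> \<le> C"
    unfolding bounded_iff real_norm_def by blast
  have "set_integrable lborel {0<..<1} (\<lambda>u. C * u powr (q - 1))"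
    by (intro set_integrable_mult_right set_integrable_powr_01 assms)
  then show ?thesis
  proof (rule set_integrable_bound)
    show "set_borel_measurable lborel {0<..<1} (F3_weight p q \<mu> x y)"
      unfolding set_borel_measurable_def by measurable
    have "\<bar>F3_weight p q \<mu> x y u\<bar> \<le> \<bar>C * u powr (q - 1)\<bar>" if "u \<in> {0<..<1}" for u
    proof -
      have "\<bar>F3_weight p q \<mu> x y u\<bar> = u powr (q - 1) * \<bar>?h u\<bar>"
        by (simp add: F3_weight_def abs_mult)
      also have "\<dots> \<le> u powr (q - 1) * C"
        using that by (intro mult_left_mono C) auto
      finally show ?thesis by (simp add: mult_ac)
    qed
    then show "AE u in lborel. u \<in> {0<..<1} \<longrightarrow> norm (F3_weight p q \<mu> x y u) \<le> norm (C * u powr (q - 1))"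
      by auto
  qed
qed

text \<open>Taylor coefficients of the integral about \<open>(x0, y0)\<close>:
  \<open>binomial_series_shifted\<close> with \<open>v = 1 - u\<close> in the first variable and
  \<open>v = u\<close> in the second leaves the weight at the centre as common factor.\<close>

definition F3_coeff :: "real \<Rightarrow> real \<Rightarrow> real \<Rightarrow> real \<Rightarrow> real \<Rightarrow> nat \<Rightarrow> nat \<Rightarrow> real" where
  "F3_coeff p q \<mu> x0 y0 m n = (pochhammer p m / fact m) * (pochhammer \<mu> n / fact n) *
     (LBINT u:{0<..<1}. F3_weight p q \<mu> x0 y0 u * ((1 - u) / (1 - (1 - u) * x0)) ^ m * (u / (1 - u * y0)) ^ n)"

lemma has_sum_F3_integral:
  assumes q: "q > 0" and x0: "x0 < 1" and y0: "y0 < 1"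
    and x: "\<bar>x - x0\<bar> < 1 - x0" and y: "\<bar>y - y0\<bar> < 1 - y0"
  shows "((\<lambda>(m, n). F3_coeff p q \<mu> x0 y0 m n * (x - x0) ^ m * (y - y0) ^ n)
            has_sum (LBINT u:{0<..<1}. F3_weight p q \<mu> x y u)) UNIV"
proof -
  define I :: "real \<Rightarrow> real" where "I = indicator {0<..<1}"
  have I_meas [measurable]: "I \<in> borel_measurable borel" by (simp add: I_def)
  define P where "P m = pochhammer p m / fact m" for m
  define Q where "Q n = pochhammer \<mu> n / fact n" for n
  define g where "g u = (1 - u) / (1 - (1 - u) * x0)" for u
  define h where "h u = u / (1 - u * y0)" for u
  have gh_meas [measurable]: "g \<in> borel_measurable borel" "h \<in> borel_measurable borel"
    unfolding g_def h_def by measurable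
  let ?W = "F3_weight p q \<mu>"
  define f where "f = (\<lambda>(m, n) u. P m * Q n * (x - x0) ^ m * (y - y0) ^ n * (I u * (?W x0 y0 u * g u ^ m * h u ^ n)))"
  \<comment> \<open>\<rho> and \<sigma> bound the two ratios for every \<open>u\<close>. They lie
    below 1 because \<open>x\<close> and \<open>y\<close> are closer to the centre than the lines
    \<open>x = 1\<close> and \<open>y = 1\<close> are; this makes \<open>A\<close> summable.\<close>
  define \<rho> where "\<rho> = \<bar>x - x0\<bar> / (1 - x0)"
  define \<sigma> where "\<sigma> = \<bar>y - y0\<bar> / (1 - y0)"
  define A where "A = (\<lambda>(m, n). (\<bar>P m\<bar> * \<rho> ^ m) * (\<bar>Q n\<bar> * \<sigma> ^ n))"
  have \<rho>: "\<bar>\<rho>\<bar> < 1" "0 \<le> \<rho>" and \<sigma>: "\<bar>\<sigma>\<bar> < 1" "0 \<le> \<sigma>"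
    using x y x0 y0 by (auto simp: \<rho>_def \<sigma>_def)
  have w: "integrable lborel (\<lambda>u. I u * ?W x0 y0 u)" and S: "integrable lborel (\<lambda>u. I u * ?W x y u)"
    using set_integrable_F3_weight[OF q, of _ _ p \<mu>] x0 y0 x y unfolding set_integrable_def I_def by auto
  have "(\<lambda>m. \<bar>P m\<bar> * \<bar>\<rho>\<bar> ^ m) summable_on UNIV" "(\<lambda>n. \<bar>Q n\<bar> * \<bar>\<sigma>\<bar> ^ n) summable_on UNIV"
    unfolding P_def Q_def by (intro binomial_series_pochhammer \<rho> \<sigma>)+
  then have A: "A summable_on UNIV"
    using \<rho> \<sigma> unfolding summable_on_def A_def by (auto dest: has_sum_times)
  have bound: "\<bar>f i u\<bar> \<le> A i * (I u * ?W x0 y0 u)" for i u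
  proof (cases "u \<in> {0<..<1}")
    case False
    then show ?thesis by (simp add: f_def I_def split: prod.split)
  next
    case u: True
    obtain m n where i: "i = (m, n)" by (cases i)
    have "\<bar>g u\<bar> * \<bar>x - x0\<bar> \<le> \<rho>" "\<bar>h u\<bar> * \<bar>y - y0\<bar> \<le> \<sigma>"
      unfolding \<rho>_def \<sigma>_def g_def h_def using u x0 y0 by (intro shifted_ratio_bound; simp)+
    then have gm: "(\<bar>g u\<bar> * \<bar>x - x0\<bar>) ^ m \<le> \<rho> ^ m" and hn: "(\<bar>h u\<bar> * \<bar>y - y0\<bar>) ^ n \<le> \<sigma> ^ n"
      by (intro power_mono; simp)+
    have "\<bar>f i u\<bar> = (\<bar>P m\<bar> * (\<bar>g u\<bar> * \<bar>x - x0\<bar>) ^ m) * (\<bar>Q n\<bar> * (\<bar>h u\<bar> * \<bar>y - y0\<bar>) ^ n) * (I u * ?W x0 y0 u)"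
      using F3_weight_nonneg[of p q \<mu> x0 y0 u] u
      by (simp add: f_def i I_def abs_mult power_abs power_mult_distrib)
    also have "\<dots> \<le> (\<bar>P m\<bar> * \<rho> ^ m) * (\<bar>Q n\<bar> * \<sigma> ^ n) * (I u * ?W x0 y0 u)"
      using gm hn \<rho> \<sigma> F3_weight_nonneg[of p q \<mu> x0 y0 u]
      by (intro mult_right_mono mult_mono mult_left_mono) (auto simp: I_def)
    finally show ?thesis by (simp add: A_def i)
  qed
  have "integrable lborel (f i)" for i
  proof (rule Bochner_Integration.integrable_bound)
    show "integrable lborel (\<lambda>u. A i * (I u * ?W x0 y0 u))"
      using w by simp
    show "f i \<in> borel_measurable lborel"
      unfolding f_def by (cases i) simp
    show "AE u in lborel. norm (f i u) \<le> norm (A i * (I u * ?W x0 y0 u))"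
      using bound[of i] by (intro AE_I2) (metis abs_ge_self order_trans real_norm_def)
  qed
  moreover have "((\<lambda>i. f i u) has_sum (I u * ?W x y u)) UNIV" for u
  proof (cases "u \<in> {0<..<1}")
    case False
    then show ?thesis by (auto simp: f_def I_def case_prod_unfold intro!: has_sum_0)
  next
    case u: True
    have 1: "((\<lambda>m. P m * g u ^ m * (x - x0) ^ m * (1 - (1 - u) * x0) powr (- p))
               has_sum (1 - (1 - u) * x) powr (- p)) UNIV"
      unfolding P_def g_def using u x0 x by (intro binomial_series_shifted) auto
    have 2: "((\<lambda>n. Q n * h u ^ n * (y - y0) ^ n * (1 - u * y0) powr (- \<mu>))
               has_sum (1 - u * y) powr (- \<mu>)) UNIV"
      unfolding Q_def h_def using u y0 y by (intro binomial_series_shifted) auto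
    have "((\<lambda>i. u powr (q - 1) * (case i of (m, n) \<Rightarrow> (P m * g u ^ m * (x - x0) ^ m * (1 - (1 - u) * x0) powr (- p)) *
             (Q n * h u ^ n * (y - y0) ^ n * (1 - u * y0) powr (- \<mu>))))
             has_sum (u powr (q - 1) * ((1 - (1 - u) * x) powr (- p) * (1 - u * y) powr (- \<mu>)))) UNIV"
      by (intro has_sum_cmult_right has_sum_times 1 2)
    then show ?thesis
      using u by (simp add: f_def I_def F3_weight_def case_prod_unfold mult_ac)
  qed
  ultimately have "((\<lambda>i. integral\<^sup>L lborel (f i)) has_sum (LINT u|lborel. I u * ?W x y u)) UNIV"
    by (intro has_sum_integral_dominated[OF _ S w A bound])
  moreover have "integral\<^sup>L lborel (f (m, n)) = F3_coeff p q \<mu> x0 y0 m n * (x - x0) ^ m * (y - y0) ^ n" for m n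
    by (simp add: f_def F3_coeff_def set_lebesgue_integral_def I_def P_def Q_def g_def h_def)
  then have "(\<lambda>i. integral\<^sup>L lborel (f i)) = (\<lambda>(m, n). F3_coeff p q \<mu> x0 y0 m n * (x - x0) ^ m * (y - y0) ^ n)"
    by auto
  ultimately show ?thesis
    by (simp add: set_lebesgue_integral_def I_def)
qed

text \<open>Multiplication by \<open>X\<close> raises the first exponent by one, so the sum is
  reindexed by \<open>Suc\<close>; the new row \<open>m = 0\<close> has coefficient 0, which also
  guards the truncated \<open>m - 1\<close>.\<close>

lemma has_sum_powser2_mult_fst:
  fixes c :: "nat \<Rightarrow> nat \<Rightarrow> real"
  assumes "((\<lambda>(m, n). c m n * X ^ m * Y ^ n) has_sum S) UNIV"
  shows "((\<lambda>(m, n). (if m = 0 then 0 else c (m - 1) n) * X ^ m * Y ^ n) has_sum (X * S)) UNIV"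
proof -
  let ?g = "\<lambda>(m, n). (if m = 0 then 0 else c (m - 1) n) * X ^ m * Y ^ n"
  have "((\<lambda>i. X * (case i of (m, n) \<Rightarrow> c m n * X ^ m * Y ^ n)) has_sum (X * S)) UNIV"
    by (intro has_sum_cmult_right assms)
  moreover have "(\<lambda>i. X * (case i of (m, n) \<Rightarrow> c m n * X ^ m * Y ^ n)) = ?g \<circ> map_prod Suc id"
    by (auto simp: fun_eq_iff)
  ultimately have "(?g has_sum (X * S)) (range (map_prod Suc id))"
    by (subst has_sum_reindex) (auto intro!: map_prod_inj_on[of Suc UNIV id UNIV, simplified])
  also have "?this \<longleftrightarrow> (?g has_sum (X * S)) UNIV"
  proof (rule has_sum_cong_neutral)
    fix i :: "nat \<times> nat" assume i: "i \<in> UNIV - range (map_prod Suc id)"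
    obtain m n where mn: "i = (m, n)" by (cases i)
    have "m = 0"
    proof (rule ccontr)
      assume "m \<noteq> 0"
      then have "i = map_prod Suc id (m - 1, n)" by (simp add: mn)
      with i show False by blast
    qed
    then show "?g i = 0" by (simp add: mn)
  qed auto
  finally show ?thesis .
qed

lemma has_sum_powser2_snd:
  fixes d :: "nat \<Rightarrow> real"
  assumes "((\<lambda>n. d n * Y ^ n) has_sum S) UNIV"
  shows "((\<lambda>(m, n). (if m = 0 then d n else 0) * X ^ m * Y ^ n) has_sum S) UNIV"
proof -
  let ?g = "\<lambda>(m, n). (if m = 0 then d n else 0) * X ^ m * Y ^ n"
  have "(\<lambda>n. d n * Y ^ n) = ?g \<circ> Pair 0"
    by (auto simp: fun_eq_iff)
  then have "(?g has_sum S) (range (Pair 0))"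
    using assms by (subst has_sum_reindex) (auto simp: inj_on_def)
  also have "?this \<longleftrightarrow> (?g has_sum S) UNIV"
    by (rule has_sum_cong_neutral) auto
  finally show ?thesis .
qed

text \<open>The first summand collects the terms \<open>m = 0\<close>, where the Beta integral would
  have second parameter 0 and diverge. The factor \<open>x\<close> compensates the shift from
  \<open>m\<close> to \<open>m - 1\<close> in the others.\<close>

definition F3_ext :: "real \<Rightarrow> real \<Rightarrow> real \<Rightarrow> real \<times> real \<Rightarrow> real" where
  "F3_ext p q \<mu> = (\<lambda>(x, y). (1 - y) powr (- \<mu>) + (p - 1) * (x * (LBINT u:{0<..<1}. F3_weight p q \<mu> x y u)))"

text \<open>The factor \<open>x\<close> in front of the integral is expanded as
  \<open>(x - x0) + x0\<close>: one part shifts the first index, the other rescales the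
  coefficients.\<close>

definition F3_ext_coeff :: "real \<Rightarrow> real \<Rightarrow> real \<Rightarrow> real \<Rightarrow> real \<Rightarrow> nat \<Rightarrow> nat \<Rightarrow> real" where
  "F3_ext_coeff p q \<mu> x0 y0 m n =
     (if m = 0 then pochhammer \<mu> n / fact n * (1 / (1 - y0)) ^ n * (1 - y0) powr (- \<mu>) else 0)
     + (p - 1) * ((if m = 0 then 0 else F3_coeff p q \<mu> x0 y0 (m - 1) n) + x0 * F3_coeff p q \<mu> x0 y0 m n)"

lemma has_sum_F3_ext:
  assumes q: "q > 0" and x0: "x0 < 1" and y0: "y0 < 1"
    and x: "\<bar>x - x0\<bar> < 1 - x0" and y: "\<bar>y - y0\<bar> < 1 - y0"
  shows "((\<lambda>(m, n). F3_ext_coeff p q \<mu> x0 y0 m n * (x - x0) ^ m * (y - y0) ^ n)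
            has_sum F3_ext p q \<mu> (x, y)) UNIV"
proof -
  let ?S = "LBINT u:{0<..<1}. F3_weight p q \<mu> x y u"
  note H = has_sum_F3_integral[OF assms, of p \<mu>]
  have "((\<lambda>n. pochhammer \<mu> n / fact n * (1 / (1 - y0)) ^ n * (1 - y0) powr (- \<mu>) * (y - y0) ^ n)
           has_sum (1 - y) powr (- \<mu>)) UNIV"
    using binomial_series_shifted[of 1 y0 y \<mu>] y0 y by (simp add: mult_ac)
  note B = has_sum_powser2_snd[OF this, of "x - x0"]
  have "(1 - y) powr (- \<mu>) + (p - 1) * ((x - x0) * ?S + x0 * ?S) = F3_ext p q \<mu> (x, y)"
    by (simp add: F3_ext_def algebra_simps)
  then show ?thesis
    using has_sum_add[OF B has_sum_cmult_right[OF has_sum_add[OF has_sum_powser2_mult_fst[OF H]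
      has_sum_cmult_right[OF H, of x0]], of "p - 1"]]
    by (simp add: F3_ext_coeff_def case_prod_unfold algebra_simps)
qed

lemma real_analytic_F3_ext:
  assumes "q > 0"
  shows "real_analytic_on2 (F3_ext p q \<mu>) {p. fst p < 1 \<and> snd p < 1}"
  unfolding real_analytic_on2_def
proof
  fix z :: "real \<times> real" assume "z \<in> {p. fst p < 1 \<and> snd p < 1}"
  then have "fst z < 1" "snd z < 1" by auto
  then show "\<exists>r>0. \<exists>c. \<forall>x y. \<bar>x - fst z\<bar> < r \<and> \<bar>y - snd z\<bar> < r \<longrightarrow>
          ((\<lambda>(m, n). c m n * (x - fst z) ^ m * (y - snd z) ^ n) has_sum F3_ext p q \<mu> (x, y)) UNIV"
    using assms
    \<comment> \<open>The radius is the distance to the nearer of the lines \<open>x = 1\<close> and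
      \<open>y = 1\<close>.\<close>
    by (intro exI[of _ "min (1 - fst z) (1 - snd z)"] conjI exI[of _ "F3_ext_coeff p q \<mu> (fst z) (snd z)"]
        allI impI has_sum_F3_ext) auto
qed

section \<open>Comparison with the double series at the origin\<close>

lemma F3_coeff_origin:
  assumes "q > 0"
  shows "F3_coeff p q \<mu> 0 0 m n = pochhammer p m * pochhammer \<mu> n / fact n * (pochhammer q n / pochhammer q (Suc m + n))"
proof -
  \<comment> \<open>At the centre 0 the bases under the exponents \<open>- \<mu>\<close> and
    \<open>- p\<close> are 1 and the integral is a Beta value; its factor \<open>fact m\<close>
    cancels against the denominator in \<open>F3_coeff\<close>.\<close>
  have "(LBINT u:{0<..<1}. F3_weight p q \<mu> 0 0 u * ((1 - u) / (1 - (1 - u) * 0)) ^ m * (u / (1 - u * 0)) ^ n)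
      = (LBINT u:{0<..<1}. u powr ((q + real n) - 1) * (1 - u) powr ((real m + 1) - 1))"
    by (rule set_lebesgue_integral_cong)
       (auto simp: F3_weight_def powr_realpow[symmetric] powr_add[symmetric] algebra_simps)
  also have "\<dots> = Beta (q + real n) (real m + 1)"
    using assms by (intro LBINT_Beta) auto
  also have "\<dots> = fact m * (pochhammer q n / pochhammer q (Suc m + n))"
  proof -
    have "q \<notin> \<int>\<^sub>\<le>\<^sub>0" using assms by auto
    then have "pochhammer q n = Gamma (q + real n) / Gamma q"
      "pochhammer q (Suc m + n) = Gamma (q + real n + (real m + 1)) / Gamma q"
      using pochhammer_Gamma[of q n] pochhammer_Gamma[of q "Suc m + n"]
      by (auto simp: add_ac simp del: pochhammer_Suc)
    moreover have "Gamma (real m + 1) = fact m"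
      by (simp add: Gamma_fact[symmetric] add.commute)
    moreover have "Gamma q > 0" using assms by simp
    ultimately show ?thesis by (simp add: Beta_def del: pochhammer_Suc)
  qed
  finally show ?thesis
    unfolding F3_coeff_def by simp
qed

text \<open>For \<open>m = 0\<close> the two factors \<open>(q)_n\<close> cancel and the binomial
  coefficients in \<open>y\<close> remain. For \<open>m = k + 1\<close> the factors
  \<open>p - 1\<close> and \<open>(p)_k\<close> combine to \<open>(p - 1)_m\<close>, while
  \<open>(1)_m\<close> cancels against \<open>m!\<close>.\<close>

lemma F3_ext_coeff_origin:
  assumes "q > 0"
  shows "F3_ext_coeff p q \<mu> 0 0 m n * x ^ m * y ^ n = appell_F3_term (p - 1) q 1 \<mu> q x y (m, n)"
proof (cases m)
  case 0
  then show ?thesis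
    using pochhammer_pos[OF assms, of n] by (simp add: F3_ext_coeff_def appell_F3_term_def)
next
  case (Suc k)
  have "pochhammer (p - 1) (Suc k) = (p - 1) * pochhammer p k"
    by (simp add: pochhammer_rec)
  then show ?thesis
    using Suc assms by (simp add: F3_ext_coeff_def appell_F3_term_def F3_coeff_origin
        pochhammer_fact[symmetric] mult_ac del: pochhammer_Suc)
qed

lemma F3_ext_eq_series:
  assumes "q > 0" "\<bar>x\<bar> < 1" "\<bar>y\<bar> < 1"
  shows "F3_ext p q \<mu> (x, y) = appell_F3_series (p - 1) q 1 \<mu> q x y"
proof -
  have "((\<lambda>(m, n). F3_ext_coeff p q \<mu> 0 0 m n * x ^ m * y ^ n) has_sum F3_ext p q \<mu> (x, y)) UNIV"
    using has_sum_F3_ext[of q 0 0 x y p \<mu>] assms by simp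
  also have "(\<lambda>(m, n). F3_ext_coeff p q \<mu> 0 0 m n * x ^ m * y ^ n) = appell_F3_term (p - 1) q 1 \<mu> q x y"
    using F3_ext_coeff_origin[OF assms(1)] by (auto simp: fun_eq_iff)
  finally show ?thesis
    unfolding appell_F3_series_def by (simp add: infsumI)
qed

section \<open>Uniqueness of the analytic extension\<close>

text \<open>The real series also converges in the complex disc of the same radius, where its sum is
  holomorphic; zeros along a real segment accumulate at \<open>z\<close>, so the identity theorem
  applies.\<close>

lemma real_powser_zero_on_interval:
  fixes a :: "nat \<Rightarrow> real" and f :: "real \<Rightarrow> real"
  assumes sums: "\<And>x. \<bar>x - x0\<bar> < r \<Longrightarrow> (\<lambda>n. a n * (x - x0) ^ n) sums f x"
    and z: "\<bar>z - x0\<bar> < r" and d: "d > 0" and zero: "\<And>x. \<bar>x - z\<bar> < d \<Longrightarrow> f x = 0"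
    and x: "\<bar>x - x0\<bar> < r"
  shows "f x = 0"
proof -
  define F where "F w = (\<Sum>n. of_real (a n) * (w - of_real x0) ^ n)" for w :: complex
  have F_sums: "(\<lambda>n. of_real (a n) * (w - of_real x0) ^ n) sums F w" if w: "w \<in> ball (of_real x0) r" for w :: complex
  proof -
    have "norm (w - of_real x0) < r"
      using w by (simp add: dist_norm norm_minus_commute)
    \<comment> \<open>Convergence at the real point \<open>x0 + y\<close>, farther out than
      \<open>w\<close>, gives convergence at the complex point \<open>w\<close>.\<close>
    then obtain y where y: "norm (w - of_real x0) < y" "y < r" using dense by blast
    then have "y > 0" using norm_ge_zero le_less_trans by blast
    have "(\<lambda>n. a n * y ^ n) sums f (x0 + y)"
      using sums[of "x0 + y"] y \<open>y > 0\<close> by simp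
    then have "summable (\<lambda>n. complex_of_real (a n * y ^ n))"
      by (intro summable_of_real sums_summable)
    then have "summable (\<lambda>n. complex_of_real (a n) * complex_of_real y ^ n)"
      by simp
    then have "summable (\<lambda>n. complex_of_real (a n) * (w - of_real x0) ^ n)"
      by (rule powser_inside) (use y \<open>y > 0\<close> in auto)
    then show ?thesis unfolding F_def by (rule summable_sums)
  qed
  have F_real: "F (of_real t) = of_real (f t)" if "\<bar>t - x0\<bar> < r" for t
  proof -
    have "(\<lambda>n. complex_of_real (a n * (t - x0) ^ n)) sums of_real (f t)"
      using sums[OF that] by (rule sums_of_real)
    moreover have "of_real t \<in> ball (complex_of_real x0) r"
      using that by (simp add: dist_of_real dist_real_def abs_minus_commute)
    ultimately show ?thesis
      using sums_unique2[OF F_sums[of "of_real t"]] by simp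
  qed
  define U where "U = complex_of_real ` {t. \<bar>t - z\<bar> < d \<and> \<bar>t - x0\<bar> < r}"
  have "F (of_real x) = 0"
  proof (rule analytic_continuation[of F "ball (of_real x0) r" U "of_real z"])
    show "F holomorphic_on ball (of_real x0) r"
      using F_sums by (rule power_series_holomorphic)
    show "U \<subseteq> ball (of_real x0) r"
      by (auto simp: U_def dist_of_real dist_real_def abs_minus_commute)
    show "of_real z \<in> ball (complex_of_real x0) r" "of_real x \<in> ball (complex_of_real x0) r"
      using z x by (auto simp: dist_of_real dist_real_def abs_minus_commute)
    have "z islimpt {t. \<bar>t - z\<bar> < d \<and> \<bar>t - x0\<bar> < r}"
    proof (rule interior_limit_point)
      have "open {t. \<bar>t - z\<bar> < d \<and> \<bar>t - x0\<bar> < r}"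
        by (intro open_Collect_conj open_Collect_less continuous_intros)
      then show "z \<in> interior {t. \<bar>t - z\<bar> < d \<and> \<bar>t - x0\<bar> < r}"
        using d z by (simp add: interior_open)
    qed
    then show "of_real z islimpt U"
      unfolding U_def by (rule islimpt_isCont_image) (auto simp: eventually_at_filter)
    show "F w = 0" if "w \<in> U" for w
      using that F_real zero by (auto simp: U_def)
  qed auto
  with F_real[OF x] show ?thesis by simp
qed

text \<open>A connectedness argument on \<open>{..<1}\<close>: each point has an interval of
  convergence, which either meets the open set \<open>T\<close> and then lies in the zero set, or
  misses \<open>T\<close> altogether. So \<open>T\<close> and its exterior \<open>T'\<close> cover
  the half-line, and \<open>T\<close> contains 0.\<close>

lemma real_analytic_1_zero_extends:
  fixes f :: "real \<Rightarrow> real"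
  assumes analytic: "\<And>x0. x0 < 1 \<Longrightarrow> \<exists>r>0. \<exists>a. \<forall>x. \<bar>x - x0\<bar> < r \<longrightarrow> (\<lambda>n. a n * (x - x0) ^ n) sums f x"
    and zero: "\<And>x. \<bar>x\<bar> < 1 \<Longrightarrow> f x = 0" and x: "x < 1"
  shows "f x = 0"
proof -
  define T where "T = interior {x. f x = 0}"
  have step: "(\<forall>t. \<bar>t - x0\<bar> < r \<longrightarrow> f t = 0)"
    if "\<forall>x. \<bar>x - x0\<bar> < r \<longrightarrow> (\<lambda>n. a n * (x - x0) ^ n) sums f x" "z \<in> T" "\<bar>z - x0\<bar> < r" for x0 r a z
  proof -
    obtain d where d: "d > 0" "ball z d \<subseteq> {x. f x = 0}"
      using \<open>z \<in> T\<close> unfolding T_def mem_interior by blast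
    have "f t = 0" if "\<bar>t - z\<bar> < d" for t
      using d(2) that by (auto simp: dist_real_def abs_minus_commute subset_eq)
    then show ?thesis
      using real_powser_zero_on_interval[of x0 r a f z d] that d(1) by blast
  qed
  define T' where "T' = interior {x. x \<notin> T}"
  have "{..<1} \<subseteq> T \<union> T'"
  proof
    fix y :: real assume "y \<in> {..<1}"
    then obtain r a where r: "r > 0" and ra: "\<forall>x. \<bar>x - y\<bar> < r \<longrightarrow> (\<lambda>n. a n * (x - y) ^ n) sums f x"
      using analytic[of y] by auto
    show "y \<in> T \<union> T'"
    proof (cases "\<exists>z\<in>T. \<bar>z - y\<bar> < r")
      case True
      then have "\<forall>t. \<bar>t - y\<bar> < r \<longrightarrow> f t = 0" using step[OF ra] by blast
      then have "ball y r \<subseteq> {x. f x = 0}" by (auto simp: dist_real_def abs_minus_commute)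
      then have "y \<in> T" using r unfolding T_def mem_interior by blast
      then show ?thesis by simp
    next
      case False
      then have "ball y r \<subseteq> {x. x \<notin> T}" by (auto simp: dist_real_def abs_minus_commute)
      then have "y \<in> T'" using r unfolding T'_def mem_interior by blast
      then show ?thesis by simp
    qed
  qed
  moreover have "0 \<in> T"
    unfolding T_def mem_interior using zero by (intro exI[of _ 1]) (auto simp: dist_real_def)
  moreover have "open T" "open T'" by (auto simp: T_def T'_def)
  moreover have "T \<inter> T' \<inter> {..<1} = {}"
    unfolding T'_def using interior_subset by blast
  moreover have "connected {..<1::real}" by simp
  ultimately have "T' \<inter> {..<1} = {}"
    using connectedD[of "{..<1::real}" T T'] by auto
  with \<open>{..<1} \<subseteq> T \<union> T'\<close> x have "x \<in> T" by auto
  then show ?thesis unfolding T_def using interior_subset by blast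
qed

section \<open>Slices of functions analytic in two variables\<close>

lemma real_analytic_on2_fst_powser:
  assumes "real_analytic_on2 G S" "(x0, y) \<in> S"
  shows "\<exists>r>0. \<exists>a. \<forall>x. \<bar>x - x0\<bar> < r \<longrightarrow> (\<lambda>n. a n * (x - x0) ^ n) sums G (x, y)"
proof -
  obtain r c where r: "r > 0"
    and c: "\<And>x y'. \<bar>x - x0\<bar> < r \<Longrightarrow> \<bar>y' - y\<bar> < r \<Longrightarrow>
      ((\<lambda>(m, n). c m n * (x - x0) ^ m * (y' - y) ^ n) has_sum G (x, y')) UNIV"
    using assms unfolding real_analytic_on2_def by fastforce
  have "(\<lambda>m. c m 0 * (x - x0) ^ m) sums G (x, y)" if "\<bar>x - x0\<bar> < r" for x
  proof -
    \<comment> \<open>At the height of the centre only the terms \<open>n = 0\<close> survive, with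
      \<open>0 ^ 0 = 1\<close>.\<close>
    have "((\<lambda>(m, n). c m n * (x - x0) ^ m * 0 ^ n) has_sum G (x, y)) UNIV"
      using c[OF that, of y] r by simp
    also have "?this \<longleftrightarrow> ((\<lambda>(m, n). c m n * (x - x0) ^ m * 0 ^ n) has_sum G (x, y)) ((\<lambda>m. (m, 0)) ` UNIV)"
      by (rule has_sum_cong_neutral) (auto simp: image_iff)
    finally show ?thesis
      by (subst (asm) has_sum_reindex) (auto simp: inj_on_def o_def intro: has_sum_imp_sums)
  qed
  with r show ?thesis by (intro exI[of _ r] conjI exI[of _ "\<lambda>m. c m 0"]) auto
qed

text \<open>Exchanging the variables turns vertical slices into horizontal ones, so one slice lemma
  serves both directions.\<close>

lemma real_analytic_on2_swap:
  assumes "real_analytic_on2 G S"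
  shows "real_analytic_on2 (G \<circ> prod.swap) (prod.swap -` S)"
  unfolding real_analytic_on2_def
proof
  fix p :: "real \<times> real" assume "p \<in> prod.swap -` S"
  then have "(snd p, fst p) \<in> S" by (cases p) auto
  then obtain r c where r: "r > 0"
    and c: "\<And>x y. \<bar>x - snd p\<bar> < r \<Longrightarrow> \<bar>y - fst p\<bar> < r \<Longrightarrow>
      ((\<lambda>(m, n). c m n * (x - snd p) ^ m * (y - fst p) ^ n) has_sum G (x, y)) UNIV"
    using assms unfolding real_analytic_on2_def by fastforce
  have "((\<lambda>(m, n). c n m * (x - fst p) ^ m * (y - snd p) ^ n) has_sum (G \<circ> prod.swap) (x, y)) UNIV"
    if "\<bar>x - fst p\<bar> < r" "\<bar>y - snd p\<bar> < r" for x y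
  proof -
    have "((\<lambda>(m, n). c m n * (y - snd p) ^ m * (x - fst p) ^ n) has_sum G (y, x)) (range prod.swap)"
      using c[OF that(2,1)] by simp
    then show ?thesis
      by (subst (asm) has_sum_reindex) (auto simp: o_def case_prod_unfold mult_ac)
  qed
  with r show "\<exists>r>0. \<exists>c. \<forall>x y. \<bar>x - fst p\<bar> < r \<and> \<bar>y - snd p\<bar> < r \<longrightarrow>
          ((\<lambda>(m, n). c m n * (x - fst p) ^ m * (y - snd p) ^ n) has_sum (G \<circ> prod.swap) (x, y)) UNIV"
    by (intro exI[of _ r] conjI exI[of _ "\<lambda>m n. c n m"]) auto
qed

text \<open>The difference of the two slices has a power series at each point, on the smaller of the
  two radii, so its zeros on \<open>\<bar>x\<bar> < 1\<close> spread to the half-line.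
  \<open>S\<close> is left general so that the swapped region fits.\<close>

lemma real_analytic_on2_slice_unique:
  assumes G1: "real_analytic_on2 G1 S" and G2: "real_analytic_on2 G2 S"
    and S: "\<And>x. x < 1 \<Longrightarrow> (x, y) \<in> S"
    and eq: "\<And>x. \<bar>x\<bar> < 1 \<Longrightarrow> G1 (x, y) = G2 (x, y)" and x: "x < 1"
  shows "G1 (x, y) = G2 (x, y)"
proof -
  have "G1 (x, y) - G2 (x, y) = 0"
  proof (rule real_analytic_1_zero_extends[of "\<lambda>x. G1 (x, y) - G2 (x, y)", OF _ _ x])
    fix x0 :: real assume "x0 < 1"
    with S have "(x0, y) \<in> S" by blast
    then obtain r a r' a' where
      *: "r > 0" "\<forall>x. \<bar>x - x0\<bar> < r \<longrightarrow> (\<lambda>n. a n * (x - x0) ^ n) sums G1 (x, y)"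
         "r' > 0" "\<forall>x. \<bar>x - x0\<bar> < r' \<longrightarrow> (\<lambda>n. a' n * (x - x0) ^ n) sums G2 (x, y)"
      using real_analytic_on2_fst_powser[OF G1] real_analytic_on2_fst_powser[OF G2] by meson
    have "(\<lambda>n. (a n - a' n) * (x - x0) ^ n) sums (G1 (x, y) - G2 (x, y))" if "\<bar>x - x0\<bar> < min r r'" for x
      using sums_diff[of "\<lambda>n. a n * (x - x0) ^ n" _ "\<lambda>n. a' n * (x - x0) ^ n"] * that
      by (simp add: left_diff_distrib)
    with * show "\<exists>r>0. \<exists>a. \<forall>x. \<bar>x - x0\<bar> < r \<longrightarrow> (\<lambda>n. a n * (x - x0) ^ n) sums (G1 (x, y) - G2 (x, y))"
      by (intro exI[of _ "min r r'"] conjI exI[of _ "\<lambda>n. a n - a' n"]) auto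
  qed (use eq in auto)
  then show ?thesis by simp
qed

lemma real_analytic_on2_unique:
  fixes G1 G2 :: "real \<times> real \<Rightarrow> real"
  defines "D \<equiv> {p. fst p < 1 \<and> snd p < 1}"
  assumes G: "real_analytic_on2 G1 D" "real_analytic_on2 G2 D"
    and eq: "\<And>x y. \<bar>x\<bar> < 1 \<Longrightarrow> \<bar>y\<bar> < 1 \<Longrightarrow> G1 (x, y) = G2 (x, y)"
    and xy: "x < 1" "y < 1"
  shows "G1 (x, y) = G2 (x, y)"
proof -
  have *: "G1 (x, y) = G2 (x, y)" if "\<bar>y\<bar> < 1" for y
    using that by (intro real_analytic_on2_slice_unique[OF G _ _ xy(1)] eq) (auto simp: D_def xy)
  \<comment> \<open>On the vertical line through \<open>x\<close> the previous step supplies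
    agreement for heights of modulus below 1, even when \<open>x\<close> itself is at most
    -1.\<close>
  have "(G1 \<circ> prod.swap) (y, x) = (G2 \<circ> prod.swap) (y, x)"
    by (rule real_analytic_on2_slice_unique[OF real_analytic_on2_swap[OF G(1)] real_analytic_on2_swap[OF G(2)]])
       (auto simp: D_def xy *)
  then show ?thesis by simp
qed

text \<open>\<open>F3_ext\<close> witnesses that the description under \<open>SOME\<close> can be
  met, and uniqueness forces whatever function is chosen to agree with it where \<open>x\<close> and
  \<open>y\<close> are below 1.\<close>

lemma appell_F3_eq_F3_ext:
  assumes "q > 0" "x < 1" "y < 1"
  shows "appell_F3 (p - 1) q 1 \<mu> q x y = F3_ext p q \<mu> (x, y)"
proof -
  let ?P = "\<lambda>G. real_analytic_on2 G {p. fst p < 1 \<and> snd p < 1} \<and>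
        (\<forall>u v. \<bar>u\<bar> < 1 \<and> \<bar>v\<bar> < 1 \<longrightarrow> G (u, v) = appell_F3_series (p - 1) q 1 \<mu> q u v)"
  have ext: "?P (F3_ext p q \<mu>)"
    using assms by (auto simp: real_analytic_F3_ext F3_ext_eq_series)
  then have some: "?P (Eps ?P)" by (rule someI[of ?P])
  show ?thesis
    unfolding appell_F3_def
    using real_analytic_on2_unique[of "Eps ?P" "F3_ext p q \<mu>" x y] ext some assms(2,3) by presburger
qed

section \<open>The extension on the curve \<open>x = 1 - \<sigma>\<close>, \<open>y = 1 - 1 / \<sigma>\<close>\<close>

text \<open>For \<open>q > 0\<close> and \<open>\<sigma> > 0\<close> this is Euler's integral for
  \<open>1 / q\<close> times Gauss's hypergeometric function
  \<open>2F1(e, 1; q + 1; 1 - \<sigma>)\<close>.\<close>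

definition F3_diag :: "real \<Rightarrow> real \<Rightarrow> real \<Rightarrow> real" where
  "F3_diag e q \<sigma> = (LBINT u:{0<..<1}. u powr (q - 1) * (u + \<sigma> * (1 - u)) powr (- e))"

lemma F3_diag_measurable [measurable]: "F3_diag e q \<in> borel_measurable borel"
  unfolding F3_diag_def set_lebesgue_integral_def by measurable

lemma F3_ext_diag:
  assumes "0 < \<sigma>" "\<sigma> < 1"
  shows "F3_ext p q \<mu> (1 - \<sigma>, 1 - 1 / \<sigma>) = \<sigma> powr \<mu> * (1 + (p - 1) * ((1 - \<sigma>) * F3_diag (p + \<mu>) q \<sigma>))"
proof -
  have "(LBINT u:{0<..<1}. F3_weight p q \<mu> (1 - \<sigma>) (1 - 1 / \<sigma>) u)
      = (LBINT u:{0<..<1}. \<sigma> powr \<mu> * (u powr (q - 1) * (u + \<sigma> * (1 - u)) powr (- (p + \<mu>))))"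
  proof (rule set_lebesgue_integral_cong; (intro ballI allI impI)?)
    fix u :: real assume u: "u \<in> {0<..<1}"
    define w where "w = u + \<sigma> * (1 - u)"
    have w: "w > 0" using u assms by (auto simp: w_def intro!: add_pos_pos)
    have "1 - u * (1 - 1 / \<sigma>) = w / \<sigma>" "1 - (1 - u) * (1 - \<sigma>) = w"
      using assms by (auto simp: w_def field_simps)
    then have "F3_weight p q \<mu> (1 - \<sigma>) (1 - 1 / \<sigma>) u = u powr (q - 1) * (w / \<sigma>) powr (- \<mu>) * w powr (- p)"
      by (simp add: F3_weight_def)
    also have "\<dots> = \<sigma> powr \<mu> * (u powr (q - 1) * w powr (- (p + \<mu>)))"
    proof -
      have "w powr (- (p + \<mu>)) = w powr (- p) * w powr (- \<mu>)"
        by (simp flip: powr_add)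
      moreover have "(w / \<sigma>) powr (- \<mu>) = w powr (- \<mu>) * \<sigma> powr \<mu>"
        using w assms by (simp add: powr_divide powr_minus field_simps)
      ultimately show ?thesis by simp
    qed
    finally show "F3_weight p q \<mu> (1 - \<sigma>) (1 - 1 / \<sigma>) u
        = \<sigma> powr \<mu> * (u powr (q - 1) * (u + \<sigma> * (1 - u)) powr (- (p + \<mu>)))"
      by (simp add: w_def)
  qed simp
  then show ?thesis
    using assms by (simp add: F3_ext_def F3_diag_def powr_minus_divide powr_divide algebra_simps)
qed

lemma set_integrable_F3_diag:
  fixes q \<sigma> e :: real
  assumes "q > 0" "\<sigma> > 0"
  shows "set_integrable lborel {0<..<1} (\<lambda>u. u powr (q - 1) * (u + \<sigma> * (1 - u)) powr (- e))"
proof -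
  have "F3_weight e q 0 (1 - \<sigma>) 0 u = u powr (q - 1) * (u + \<sigma> * (1 - u)) powr (- e)" for u
    by (simp add: F3_weight_def algebra_simps)
  then show ?thesis
    using set_integrable_F3_weight[of q "1 - \<sigma>" 0 e 0] assms by (simp add: set_integrable_def)
qed

section \<open>Moments of the diagonal integral by Tonelli's theorem\<close>

lemma ennreal_F3_diag:
  assumes "q > 0" "\<sigma> > 0"
  shows "ennreal (F3_diag e q \<sigma>)
    = (\<integral>\<^sup>+u. ennreal (indicator {0<..<1} u * (u powr (q - 1) * (u + \<sigma> * (1 - u)) powr (- e))) \<partial>lborel)"
  using set_integrable_F3_diag[OF assms, of e]
  unfolding F3_diag_def set_lebesgue_integral_def set_integrable_def
  by (subst nn_integral_eq_integral[symmetric]) auto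

lemma F3_diag_nonneg: "F3_diag e q \<sigma> \<ge> 0"
  unfolding F3_diag_def set_lebesgue_integral_def by (intro integral_nonneg_AE) auto

text \<open>Substitution \<open>w = \<sigma> + (1 - \<sigma>) * u\<close>. The factor
  \<open>w - \<sigma>\<close> yields the power \<open>q - 1\<close> of \<open>1 - \<sigma>\<close>,
  the Jacobian one more.\<close>

lemma nn_integral_F3_diag_inner:
  fixes \<sigma> q e :: real
  assumes \<sigma>: "0 < \<sigma>" "\<sigma> < 1" and q: "q > 0"
  shows "ennreal ((1 - \<sigma>) powr q * F3_diag e q \<sigma>)
       = (\<integral>\<^sup>+w. ennreal (indicator {\<sigma><..<1} w * ((w - \<sigma>) powr (q - 1) * w powr (- e))) \<partial>lborel)"
proof -
  have "(\<integral>\<^sup>+w. ennreal (indicator {\<sigma><..<1} w * ((w - \<sigma>) powr (q - 1) * w powr (- e))) \<partial>lborel)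
     = ennreal \<bar>1 - \<sigma>\<bar> * (\<integral>\<^sup>+u. ennreal (indicator {\<sigma><..<1} (\<sigma> + (1 - \<sigma>) * u) *
         (((\<sigma> + (1 - \<sigma>) * u) - \<sigma>) powr (q - 1) * (\<sigma> + (1 - \<sigma>) * u) powr (- e))) \<partial>lborel)"
    using \<sigma> by (intro nn_integral_real_affine) auto
  also have "(\<lambda>u. ennreal (indicator {\<sigma><..<1} (\<sigma> + (1 - \<sigma>) * u) *
         (((\<sigma> + (1 - \<sigma>) * u) - \<sigma>) powr (q - 1) * (\<sigma> + (1 - \<sigma>) * u) powr (- e))))
     = (\<lambda>u. ennreal ((1 - \<sigma>) powr (q - 1)) * ennreal (indicator {0<..<1} u * (u powr (q - 1) * (u + \<sigma> * (1 - u)) powr (- e))))"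
  proof
    fix u :: real
    have 1: "indicator {\<sigma><..<1} (\<sigma> + (1 - \<sigma>) * u) = (indicator {0<..<1} u :: real)"
    proof -
      have "\<sigma> + (1 - \<sigma>) * u < 1 \<longleftrightarrow> (1 - \<sigma>) * u < (1 - \<sigma>) * 1" by (simp add: algebra_simps)
      also have "\<dots> \<longleftrightarrow> u < 1" using \<sigma> by (subst mult_less_cancel_left_pos) auto
      finally show ?thesis using \<sigma> by (auto simp: indicator_def zero_less_mult_iff)
    qed
    have 2: "\<sigma> + (1 - \<sigma>) * u = u + \<sigma> * (1 - u)" by (simp add: algebra_simps)
    have 3: "((\<sigma> + (1 - \<sigma>) * u) - \<sigma>) powr (q - 1) = (1 - \<sigma>) powr (q - 1) * u powr (q - 1)" if "u \<in> {0<..<1}"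
      using that \<sigma> by (simp add: powr_mult)
    show "ennreal (indicator {\<sigma><..<1} (\<sigma> + (1 - \<sigma>) * u) *
         (((\<sigma> + (1 - \<sigma>) * u) - \<sigma>) powr (q - 1) * (\<sigma> + (1 - \<sigma>) * u) powr (- e)))
      = ennreal ((1 - \<sigma>) powr (q - 1)) * ennreal (indicator {0<..<1} u * (u powr (q - 1) * (u + \<sigma> * (1 - u)) powr (- e)))"
    proof (cases "u \<in> {0<..<1}")
      case True
      show ?thesis unfolding 1 3[OF True] unfolding 2 by (simp add: ennreal_mult[symmetric] mult_ac)
    qed (simp add: 1)
  qed
  also have "(\<integral>\<^sup>+u. ennreal ((1 - \<sigma>) powr (q - 1)) * ennreal (indicator {0<..<1} u * (u powr (q - 1) * (u + \<sigma> * (1 - u)) powr (- e))) \<partial>lborel)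
     = ennreal ((1 - \<sigma>) powr (q - 1)) * ennreal (F3_diag e q \<sigma>)"
    using \<sigma> by (simp add: nn_integral_cmult ennreal_F3_diag[OF q])
  also have "ennreal \<bar>1 - \<sigma>\<bar> * (ennreal ((1 - \<sigma>) powr (q - 1)) * ennreal (F3_diag e q \<sigma>))
     = ennreal ((1 - \<sigma>) powr q * F3_diag e q \<sigma>)"
    using \<sigma> F3_diag_nonneg[of e q \<sigma>]
    by (simp add: ennreal_mult[symmetric] mult.assoc[symmetric] powr_mult_base)
  finally show ?thesis by simp
qed

lemma Beta_one_right:
  assumes "(\<alpha>::real) > 0"
  shows "Beta \<alpha> 1 = 1 / \<alpha>"
proof -
  have "Gamma (\<alpha> + 1) = \<alpha> * Gamma \<alpha>"
    using assms by (intro Gamma_plus1) auto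
  moreover have "Gamma \<alpha> \<noteq> 0" using assms Gamma_real_pos[of \<alpha>] by linarith
  ultimately show ?thesis using assms by (simp add: Beta_def)
qed

text \<open>Substitution \<open>\<sigma> = w * v\<close>; the exponents of \<open>w\<close> are
  \<open>A - 1\<close>, \<open>q - 1\<close>, and 1 from the Jacobian.\<close>

lemma nn_integral_Beta_scaled:
  fixes A q w :: real
  assumes "A > 0" "q > 0" "w > 0"
  shows "(\<integral>\<^sup>+\<sigma>. ennreal (indicator {0<..<w} \<sigma> * (\<sigma> powr (A - 1) * (w - \<sigma>) powr (q - 1))) \<partial>lborel)
     = ennreal (w powr (A + q - 1) * Beta A q)"
proof -
  have "(\<integral>\<^sup>+\<sigma>. ennreal (indicator {0<..<w} \<sigma> * (\<sigma> powr (A - 1) * (w - \<sigma>) powr (q - 1))) \<partial>lborel)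
     = ennreal \<bar>w\<bar> * (\<integral>\<^sup>+v. ennreal (indicator {0<..<w} (0 + w * v) * ((0 + w * v) powr (A - 1) * (w - (0 + w * v)) powr (q - 1))) \<partial>lborel)"
    using assms by (intro nn_integral_real_affine) auto
  also have "(\<lambda>v. ennreal (indicator {0<..<w} (0 + w * v) * ((0 + w * v) powr (A - 1) * (w - (0 + w * v)) powr (q - 1))))
    = (\<lambda>v. ennreal (w powr (A + q - 2)) * ennreal (indicator {0<..<1} v * (v powr (A - 1) * (1 - v) powr (q - 1))))"
  proof
    fix v :: real
    have ind: "indicator {0<..<w} (0 + w * v) = (indicator {0<..<1} v :: real)"
      using assms mult_less_cancel_left_pos[of w v 1] by (auto simp: indicator_def zero_less_mult_iff)
    show "ennreal (indicator {0<..<w} (0 + w * v) * ((0 + w * v) powr (A - 1) * (w - (0 + w * v)) powr (q - 1)))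
      = ennreal (w powr (A + q - 2)) * ennreal (indicator {0<..<1} v * (v powr (A - 1) * (1 - v) powr (q - 1)))"
    proof (cases "v \<in> {0<..<1}")
      case True
      have "w - (0 + w * v) = w * (1 - v)" by (simp add: algebra_simps)
      then have "(0 + w * v) powr (A - 1) * (w - (0 + w * v)) powr (q - 1)
         = (w powr (A - 1) * w powr (q - 1)) * (v powr (A - 1) * (1 - v) powr (q - 1))"
        using True assms by (simp add: powr_mult)
      also have "w powr (A - 1) * w powr (q - 1) = w powr (A + q - 2)"
        by (simp add: powr_add[symmetric])
      finally show ?thesis
        unfolding ind using True by (simp add: ennreal_mult[symmetric])
    qed (simp only: ind, simp)
  qed
  also have "(\<integral>\<^sup>+v. ennreal (w powr (A + q - 2)) * ennreal (indicator {0<..<1} v * (v powr (A - 1) * (1 - v) powr (q - 1))) \<partial>lborel)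
    = ennreal (w powr (A + q - 2)) * ennreal (Beta A q)"
    using assms by (simp add: nn_integral_cmult nn_integral_Beta)
  also have "ennreal \<bar>w\<bar> * (ennreal (w powr (A + q - 2)) * ennreal (Beta A q)) = ennreal (w powr (A + q - 1) * Beta A q)"
    using assms by (simp add: ennreal_mult[symmetric] Beta_def mult.assoc[symmetric] powr_mult_base)
  finally show ?thesis .
qed

text \<open>Over the triangle \<open>0 < \<sigma> < w < 1\<close> the order of integration is
  exchanged. The inner integral in \<sigma> is a scaled Beta value, and the outer one of
  \<open>w powr (A + q - e - 1)\<close> is \<open>1 / (A + q - e)\<close>.\<close>

lemma has_bochner_integral_F3_diag:
  fixes A q e :: real
  assumes A: "A > 0" and q: "q > 0" and Aqe: "A + q > e"
  shows "has_bochner_integral lborel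
           (\<lambda>\<sigma>. indicator {0<..<1} \<sigma> * (\<sigma> powr (A - 1) * ((1 - \<sigma>) powr q * F3_diag e q \<sigma>)))
           (Beta A q / (A + q - e))"
proof (rule has_bochner_integral_nn_integral)
  let ?k = "\<lambda>\<sigma> w. indicator {0<..<1} \<sigma> * (indicator {\<sigma><..<1} w * (\<sigma> powr (A - 1) * ((w - \<sigma>) powr (q - 1) * w powr (- e))))"
  \<comment> \<open>The interval depends on \<sigma>, so the exchange needs its indicator to be
    measurable in both variables jointly.\<close>
  have [measurable]: "(\<lambda>(\<sigma>::real, w::real). indicator {\<sigma><..<1} w :: real) \<in> borel_measurable (borel \<Otimes>\<^sub>M borel)"
    unfolding indicator_def greaterThanLessThan_iff case_prod_unfold by measurable
  have "(\<integral>\<^sup>+\<sigma>. ennreal (indicator {0<..<1} \<sigma> * (\<sigma> powr (A - 1) * ((1 - \<sigma>) powr q * F3_diag e q \<sigma>))) \<partial>lborel)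
      = (\<integral>\<^sup>+\<sigma>. (\<integral>\<^sup>+w. ennreal (?k \<sigma> w) \<partial>lborel) \<partial>lborel)"
  proof (rule nn_integral_cong)
    fix \<sigma> :: real
    show "ennreal (indicator {0<..<1} \<sigma> * (\<sigma> powr (A - 1) * ((1 - \<sigma>) powr q * F3_diag e q \<sigma>)))
       = (\<integral>\<^sup>+w. ennreal (?k \<sigma> w) \<partial>lborel)"
    proof (cases "\<sigma> \<in> {0<..<1}")
      case True
      then have "ennreal (indicator {0<..<1} \<sigma> * (\<sigma> powr (A - 1) * ((1 - \<sigma>) powr q * F3_diag e q \<sigma>)))
        = ennreal (\<sigma> powr (A - 1)) * ennreal ((1 - \<sigma>) powr q * F3_diag e q \<sigma>)"
        using F3_diag_nonneg[of e q \<sigma>] by (simp add: ennreal_mult[symmetric])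
      also have "\<dots> = (\<integral>\<^sup>+w. ennreal (\<sigma> powr (A - 1)) * ennreal (indicator {\<sigma><..<1} w * ((w - \<sigma>) powr (q - 1) * w powr (- e))) \<partial>lborel)"
        using True q by (subst nn_integral_cmult) (auto simp: nn_integral_F3_diag_inner)
      also have "\<dots> = (\<integral>\<^sup>+w. ennreal (?k \<sigma> w) \<partial>lborel)"
        using True by (intro nn_integral_cong) (auto simp: ennreal_mult[symmetric] mult_ac)
      finally show ?thesis .
    qed simp
  qed
  also have "\<dots> = (\<integral>\<^sup>+w. (\<integral>\<^sup>+\<sigma>. ennreal (?k \<sigma> w) \<partial>lborel) \<partial>lborel)"
    by (rule lborel_pair.Fubini') measurable
  \<comment> \<open>The factor \<open>(1 - w) powr (1 - 1)\<close> equals 1 on the interval; it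
    casts the outer integral as \<open>Beta (A + q - e) 1\<close>.\<close>
  also have "\<dots> = (\<integral>\<^sup>+w. ennreal (Beta A q) * ennreal (indicator {0<..<1} w * (w powr ((A + q - e) - 1) * (1 - w) powr (1 - 1))) \<partial>lborel)"
  proof (rule nn_integral_cong)
    fix w :: real
    show "(\<integral>\<^sup>+\<sigma>. ennreal (?k \<sigma> w) \<partial>lborel)
      = ennreal (Beta A q) * ennreal (indicator {0<..<1} w * (w powr ((A + q - e) - 1) * (1 - w) powr (1 - 1)))"
    proof (cases "w \<in> {0<..<1}")
      case True
      then have "(\<integral>\<^sup>+\<sigma>. ennreal (?k \<sigma> w) \<partial>lborel)
        = (\<integral>\<^sup>+\<sigma>. ennreal (w powr (- e)) * ennreal (indicator {0<..<w} \<sigma> * (\<sigma> powr (A - 1) * (w - \<sigma>) powr (q - 1))) \<partial>lborel)"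
        by (intro nn_integral_cong) (auto simp: indicator_def ennreal_mult[symmetric] mult_ac)
      also have "\<dots> = ennreal (w powr (- e)) * ennreal (w powr (A + q - 1) * Beta A q)"
        using True A q by (subst nn_integral_cmult) (auto simp: nn_integral_Beta_scaled)
      also have "\<dots> = ennreal (w powr (- e) * w powr (A + q - 1) * Beta A q)"
        using A q by (simp add: ennreal_mult[symmetric] Beta_def mult_ac)
      also have "w powr (- e) * w powr (A + q - 1) = w powr ((A + q - e) - 1)"
        by (simp add: powr_add[symmetric] algebra_simps)
      finally show ?thesis
        using True A q by (simp add: ennreal_mult[symmetric] Beta_def mult_ac)
    next
      case False
      then have "?k \<sigma> w = 0" for \<sigma> by (auto simp: indicator_def)
      then have "(\<integral>\<^sup>+\<sigma>. ennreal (?k \<sigma> w) \<partial>lborel) = 0" by (simp only: ennreal_0 nn_integral_const mult_zero_left)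
      with False show ?thesis by simp
    qed
  qed
  also have "\<dots> = ennreal (Beta A q) * ennreal (Beta (A + q - e) 1)"
    using Aqe by (subst nn_integral_cmult) (simp_all only: nn_integral_Beta, auto)
  also have "\<dots> = ennreal (Beta A q / (A + q - e))"
    using assms by (subst Beta_one_right) (simp_all add: ennreal_mult[symmetric] Beta_def)
  finally show "(\<integral>\<^sup>+\<sigma>. ennreal (indicator {0<..<1} \<sigma> * (\<sigma> powr (A - 1) * ((1 - \<sigma>) powr q * F3_diag e q \<sigma>))) \<partial>lborel)
      = ennreal (Beta A q / (A + q - e))" .
  show "0 \<le> Beta A q / (A + q - e)"
    using assms by (simp add: Beta_def)
qed (auto simp: F3_diag_nonneg)

section \<open>The substitution of \<open>s powr a\<close> in integrals over the unit
  interval\<close>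

lemma powr_image_01:
  assumes "(a::real) > 0"
  shows "(\<lambda>s. s powr a) ` {0<..<1} = {0<..<1}"
proof (intro equalityI subsetI)
  fix y :: real assume y: "y \<in> {0<..<1}"
  then have "y = (y powr (1 / a)) powr a" "y powr (1 / a) \<in> {0<..<1}"
    using assms powr_less_mono2[of "1 / a" y 1] by (auto simp: powr_powr)
  then show "y \<in> (\<lambda>s. s powr a) ` {0<..<1}" by blast
next
  fix y :: real assume "y \<in> (\<lambda>s. s powr a) ` {0<..<1}"
  then obtain s where "y = s powr a" "0 < s" "s < 1" by auto
  then show "y \<in> {0<..<1}"
    using assms powr_less_mono2[of a s 1] by simp
qed

text \<open>The change of variables theorem speaks of \<open>lebesgue\<close>; Borel measurability
  allows passing from \<open>lborel\<close> to its completion and back. The Jacobian is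
  \<open>a * s powr (a - 1)\<close>.\<close>

lemma
  fixes f :: "real \<Rightarrow> real"
  assumes a: "a > 0" and f_meas [measurable]: "f \<in> borel_measurable borel"
    and f: "set_integrable lborel {0<..<1} f"
  shows set_integrable_powr_substitution:
      "set_integrable lborel {0<..<1} (\<lambda>s. a * s powr (a - 1) * f (s powr a))"
    and LBINT_powr_substitution:
      "(LBINT s:{0<..<1}. a * s powr (a - 1) * f (s powr a)) = (LBINT \<sigma>:{0<..<1}. f \<sigma>)"
proof -
  have f': "f absolutely_integrable_on {0<..<1}"
    using f unfolding set_integrable_def by (subst integrable_completion) auto
  have eq: "integral {0<..<1} f = (LBINT \<sigma>:{0<..<1}. f \<sigma>)"
    using set_borel_integral_eq_integral(2)[OF f] by simp
  have "(\<lambda>s. \<bar>a * s powr (a - 1)\<bar> * f (s powr a)) absolutely_integrable_on {0<..<1} \<and>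
          integral {0<..<1} (\<lambda>s. \<bar>a * s powr (a - 1)\<bar> * f (s powr a)) = (LBINT \<sigma>:{0<..<1}. f \<sigma>) \<longleftrightarrow>
     f absolutely_integrable_on (\<lambda>s. s powr a) ` {0<..<1} \<and>
          integral ((\<lambda>s. s powr a) ` {0<..<1}) f = (LBINT \<sigma>:{0<..<1}. f \<sigma>)"
  proof (rule has_absolute_integral_change_of_variables_1')
    show "((\<lambda>s. s powr a) has_field_derivative a * x powr (a - 1)) (at x within {0<..<1})" if "x \<in> {0<..<1}" for x
      using that by (auto intro!: derivative_eq_intros)
    show "inj_on (\<lambda>s. s powr a) {0<..<1}"
    proof (rule inj_onI)
      fix x y :: real assume "x \<in> {0<..<1}" "y \<in> {0<..<1}" "x powr a = y powr a"
      then show "x = y"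
        using a powr_less_mono2[of a x y] powr_less_mono2[of a y x] by (cases x y rule: linorder_cases) auto
    qed
  qed auto
  then have *: "(\<lambda>s. a * s powr (a - 1) * f (s powr a)) absolutely_integrable_on {0<..<1}"
      "integral {0<..<1} (\<lambda>s. a * s powr (a - 1) * f (s powr a)) = (LBINT \<sigma>:{0<..<1}. f \<sigma>)"
    using a f' eq by (auto simp: powr_image_01)
  then show **: "set_integrable lborel {0<..<1} (\<lambda>s. a * s powr (a - 1) * f (s powr a))"
    unfolding set_integrable_def by (subst (asm) integrable_completion) auto
  show "(LBINT s:{0<..<1}. a * s powr (a - 1) * f (s powr a)) = (LBINT \<sigma>:{0<..<1}. f \<sigma>)"
    using set_borel_integral_eq_integral(2)[OF **] *(2) by simp
qed

section \<open>The kernel\<close>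

text \<open>The function of \<open>\<sigma> = s powr a\<close> left of the kernel once the constant
  \<open>1 / Gamma q\<close> and the Jacobian \<open>a * s powr (a - 1)\<close> are split off. The
  exponent \<open>A\<close> absorbs any extra power of \<open>s\<close>.\<close>

definition kernel_profile :: "real \<Rightarrow> real \<Rightarrow> real \<Rightarrow> real \<Rightarrow> real \<Rightarrow> real" where
  "kernel_profile p q \<mu> A \<sigma> =
     \<sigma> powr (A - 1) * (1 - \<sigma>) powr (q - 1) * (1 + (p - 1) * ((1 - \<sigma>) * F3_diag (p + \<mu>) q \<sigma>))"

lemma kernel_profile_measurable [measurable]: "kernel_profile p q \<mu> A \<in> borel_measurable borel"
  unfolding kernel_profile_def by measurable

text \<open>Among the collected powers of \<open>s\<close> one factor \<open>s powr (a - 1)\<close>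
  is kept as Jacobian, and the rest is a power of \<sigma>. Taking \<open>x = n\<close> treats the
  moments, \<open>x = 0\<close> the kernel itself.\<close>

lemma kernel_k_eq_profile:
  fixes a b \<mu> \<nu> s x :: real
  assumes a: "a > 0" and b: "b > 0" and s: "0 < s" "s < 1"
  shows "kernel_k a b \<mu> \<nu> 1 s * s powr (b * x) =
    1 / Gamma (b / a) * (a * s powr (a - 1) * kernel_profile (\<nu> / a) (b / a) \<mu> (\<nu> / a + \<mu> + b / a * x) (s powr a))"
proof -
  define p where "p = \<nu> / a"
  define q where "q = b / a"
  define \<sigma> where "\<sigma> = s powr a"
  have \<nu>: "\<nu> = a * p" and b': "b = a * q" using a by (auto simp: p_def q_def)
  have \<sigma>: "0 < \<sigma>" "\<sigma> < 1" using s a powr_less_mono2[of a s 1] by (auto simp: \<sigma>_def)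
  have q: "q > 0" using a b by (simp add: q_def)
  have "(1 / s) powr a = 1 / \<sigma>" using s by (simp add: \<sigma>_def powr_divide)
  then have "kernel_k a b \<mu> \<nu> 1 s = a / Gamma q * (1 - \<sigma>) powr (q - 1) * s powr (\<nu> - 1) * appell_F3 (p - 1) q 1 \<mu> q (1 - \<sigma>) (1 - 1 / \<sigma>)"
    by (simp add: kernel_k_def p_def q_def \<sigma>_def)
  also have "appell_F3 (p - 1) q 1 \<mu> q (1 - \<sigma>) (1 - 1 / \<sigma>) = F3_ext p q \<mu> (1 - \<sigma>, 1 - 1 / \<sigma>)"
    using \<sigma> q by (intro appell_F3_eq_F3_ext) auto
  also have "\<dots> = \<sigma> powr \<mu> * (1 + (p - 1) * ((1 - \<sigma>) * F3_diag (p + \<mu>) q \<sigma>))"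
    by (rule F3_ext_diag[OF \<sigma>])
  finally have k: "kernel_k a b \<mu> \<nu> 1 s * s powr (b * x) = a / Gamma q * (1 - \<sigma>) powr (q - 1)
      * (s powr (\<nu> - 1) * \<sigma> powr \<mu> * s powr (b * x)) * (1 + (p - 1) * ((1 - \<sigma>) * F3_diag (p + \<mu>) q \<sigma>))"
    by (simp only: mult_ac)
  have "s powr (\<nu> - 1) * \<sigma> powr \<mu> * s powr (b * x) = s powr (a - 1) * \<sigma> powr (p + \<mu> + q * x - 1)"
    using s by (simp add: \<sigma>_def powr_powr powr_add[symmetric] \<nu> b' algebra_simps)
  then show ?thesis
    unfolding k by (simp add: kernel_profile_def p_def q_def \<sigma>_def mult_ac)
qed

text \<open>The summand 1 gives a Beta value, the other one the moment of \<open>F3_diag\<close>;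
  its spare factor \<open>1 - \<sigma>\<close> raises the exponent \<open>q - 1\<close> to
  \<open>q\<close>, as that moment requires.\<close>

lemma
  fixes p q \<mu> A :: real
  assumes A: "A > 0" and q: "q > 0" and Aqe: "A + q > p + \<mu>"
  shows set_integrable_kernel_profile: "set_integrable lborel {0<..<1} (kernel_profile p q \<mu> A)"
    and LBINT_kernel_profile:
      "(LBINT \<sigma>:{0<..<1}. kernel_profile p q \<mu> A \<sigma>) = Beta A q * (1 + (p - 1) / (A + q - (p + \<mu>)))"
proof -
  let ?I = "indicator {0<..<1} :: real \<Rightarrow> real"
  have "has_bochner_integral lborel (\<lambda>\<sigma>. ?I \<sigma> * (\<sigma> powr (A - 1) * (1 - \<sigma>) powr (q - 1))) (Beta A q)"
    using set_integrable_Beta[OF A q] LBINT_Beta[OF A q]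
    by (simp add: set_integrable_def set_lebesgue_integral_def has_bochner_integral_iff)
  from has_bochner_integral_add[OF this has_bochner_integral_mult_right[OF has_bochner_integral_F3_diag[OF A q Aqe], of "p - 1"]]
  have "has_bochner_integral lborel (\<lambda>\<sigma>. ?I \<sigma> * (\<sigma> powr (A - 1) * (1 - \<sigma>) powr (q - 1))
      + (p - 1) * (?I \<sigma> * (\<sigma> powr (A - 1) * ((1 - \<sigma>) powr q * F3_diag (p + \<mu>) q \<sigma>))))
     (Beta A q * (1 + (p - 1) / (A + q - (p + \<mu>))))"
    by (simp add: algebra_simps)
  moreover have "?I \<sigma> * (\<sigma> powr (A - 1) * (1 - \<sigma>) powr (q - 1))
      + (p - 1) * (?I \<sigma> * (\<sigma> powr (A - 1) * ((1 - \<sigma>) powr q * F3_diag (p + \<mu>) q \<sigma>)))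
      = ?I \<sigma> * kernel_profile p q \<mu> A \<sigma>" for \<sigma>
  proof (cases "\<sigma> \<in> {0<..<1}")
    case True
    have "(1 - \<sigma>) powr q = (1 - \<sigma>) powr (q - 1) * (1 - \<sigma>)"
      using True by (simp add: powr_mult_base mult.commute)
    then show ?thesis unfolding kernel_profile_def by algebra
  qed simp
  ultimately have "has_bochner_integral lborel (\<lambda>\<sigma>. ?I \<sigma> * kernel_profile p q \<mu> A \<sigma>)
     (Beta A q * (1 + (p - 1) / (A + q - (p + \<mu>))))" by simp
  then show "set_integrable lborel {0<..<1} (kernel_profile p q \<mu> A)"
    "(LBINT \<sigma>:{0<..<1}. kernel_profile p q \<mu> A \<sigma>) = Beta A q * (1 + (p - 1) / (A + q - (p + \<mu>)))"
    by (simp_all add: set_integrable_def set_lebesgue_integral_def has_bochner_integral_iff)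
qed

text \<open>Since \<open>A n + q - (\<nu> / a + \<mu>) = q * (n + 1)\<close>, the second factor of
  the profile moment is \<open>1 + (\<nu> - a) / (b * (n + 1))\<close>, here put over the
  denominator \<open>n + 1\<close>. The \<open>Gamma q\<close> of the kernel cancels that of the
  Beta value.\<close>

lemma kernel_k_moment:
  fixes a b \<mu> \<nu> :: real
  assumes a: "a > 0" and b: "b > 0" and e: "\<nu> / a + \<mu> > 0"
  defines "A \<equiv> \<lambda>n. \<nu> / a + \<mu> + b / a * real n"
  shows "(LBINT s:{0<..<1}. kernel_k a b \<mu> \<nu> 1 s * s powr (b * real n))
     = Gamma (A n) / Gamma (A (Suc n)) * ((1 + (\<nu> - a) / b + real n) / real (Suc n))"
proof -
  define p where "p = \<nu> / a"
  define q where "q = b / a"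
  have q: "q > 0" and An: "A n > 0" using a b e by (auto simp: q_def A_def intro!: add_pos_nonneg)
  have A': "A n + q - (p + \<mu>) = q * real (Suc n)" by (simp add: A_def p_def q_def algebra_simps add_divide_distrib)
  have "q * real (Suc n) > 0" using q by simp
  then have Aqe: "A n + q > p + \<mu>" using A' by linarith
  note int = set_integrable_kernel_profile[OF An q Aqe] LBINT_kernel_profile[OF An q Aqe]
  have "(LBINT s:{0<..<1}. kernel_k a b \<mu> \<nu> 1 s * s powr (b * real n))
      = (LBINT s:{0<..<1}. 1 / Gamma q * (a * s powr (a - 1) * kernel_profile p q \<mu> (A n) (s powr a)))"
    using a b by (intro set_lebesgue_integral_cong) (auto simp: kernel_k_eq_profile p_def q_def A_def)
  also have "\<dots> = 1 / Gamma q * (LBINT \<sigma>:{0<..<1}. kernel_profile p q \<mu> (A n) \<sigma>)"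
    by (simp add: LBINT_powr_substitution[OF a _ int(1)] del: times_divide_eq_left)
  also have "\<dots> = 1 / Gamma q * (Beta (A n) q * (1 + (p - 1) / (q * real (Suc n))))"
    unfolding int(2) A' ..
  also have "\<dots> = Gamma (A n) / Gamma (A n + q) * (1 + (p - 1) / (q * real (Suc n)))"
    using Gamma_real_pos[OF q] by (simp add: Beta_def)
  also have "A n + q = A (Suc n)" by (simp add: A_def q_def algebra_simps add_divide_distrib)
  also have "1 + (p - 1) / (q * real (Suc n)) = (1 + (\<nu> - a) / b + real n) / real (Suc n)"
  proof -
    have "(\<nu> - a) / b = (p - 1) / q" using a b by (simp add: p_def q_def field_simps)
    then have "(\<nu> - a) / b / real (Suc n) = (p - 1) / (q * real (Suc n))" by simp
    moreover have "(1 + (\<nu> - a) / b + real n) / real (Suc n) = 1 + (\<nu> - a) / b / real (Suc n)"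
    proof -
      have "1 + (\<nu> - a) / b + real n = real (Suc n) + (\<nu> - a) / b" by simp
      then show ?thesis by (simp only: add_divide_distrib) simp
    qed
    ultimately show ?thesis by simp
  qed
  finally show ?thesis .
qed

text \<open>The arguments of \<open>appell_F3\<close> depend only on the quotient of the variables;
  the remaining exponents of \<open>t\<close> are \<open>b - a\<close>, \<open>a - \<nu>\<close> and
  \<open>\<nu> - 1\<close>, with sum \<open>b - 1\<close>.\<close>

lemma kernel_k_homogeneous:
  fixes a b \<mu> \<nu> t s :: real
  assumes "a > 0" "t > 0" "0 < s" "s < 1"
  shows "kernel_k a b \<mu> \<nu> t (t * s) = t powr (b - 1) * kernel_k a b \<mu> \<nu> 1 s"
proof -
  have \<sigma>: "s powr a < 1" using assms powr_less_mono2[of a s 1] by simp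
  have "t powr a - (t * s) powr a = t powr a * (1 - s powr a)"
    using assms by (simp add: powr_mult algebra_simps)
  then have "(t powr a - (t * s) powr a) powr (b / a - 1) * t powr (a - \<nu>) * (t * s) powr (\<nu> - 1)
    = (t powr (a * (b / a - 1)) * t powr (a - \<nu>) * t powr (\<nu> - 1)) * ((1 - s powr a) powr (b / a - 1) * s powr (\<nu> - 1))"
    using assms \<sigma> by (simp add: powr_mult powr_powr)
  also have "t powr (a * (b / a - 1)) * t powr (a - \<nu>) * t powr (\<nu> - 1) = t powr (b - 1)"
    using assms by (simp add: powr_add[symmetric] algebra_simps)
  finally have *: "(t powr a - (t * s) powr a) powr (b / a - 1) * t powr (a - \<nu>) * (t * s) powr (\<nu> - 1)
    = t powr (b - 1) * ((1 - s powr a) powr (b / a - 1) * s powr (\<nu> - 1))" .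
  have "kernel_k a b \<mu> \<nu> t (t * s) = a / Gamma (b / a) *
     ((t powr a - (t * s) powr a) powr (b / a - 1) * t powr (a - \<nu>) * (t * s) powr (\<nu> - 1)) *
     appell_F3 (\<nu> / a - 1) (b / a) 1 \<mu> (b / a) (1 - s powr a) (1 - (1 / s) powr a)"
    using assms by (simp add: kernel_k_def mult.assoc)
  then show ?thesis
    unfolding * by (simp add: kernel_k_def mult_ac)
qed

section \<open>Measurability and size of the kernel\<close>

lemma set_borel_measurable_kernel_k:
  fixes a b \<mu> \<nu> :: real
  assumes "a > 0" "b > 0"
  shows "set_borel_measurable lborel {0<..<1} (kernel_k a b \<mu> \<nu> 1)"
proof -
  \<comment> \<open>\<open>appell_F3\<close> is given by a choice, so measurability is read off from
    the explicit profile, with \<open>x = 0\<close>.\<close>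
  have "indicator {0<..<1} s *\<^sub>R kernel_k a b \<mu> \<nu> 1 s = indicator {0<..<1} s *
    (1 / Gamma (b / a) * (a * s powr (a - 1) * kernel_profile (\<nu> / a) (b / a) \<mu> (\<nu> / a + \<mu>) (s powr a)))" for s
    using kernel_k_eq_profile[OF assms, of s \<mu> \<nu> 0] by (auto simp: indicator_def)
  then show ?thesis
    unfolding set_borel_measurable_def by (simp only:) measurable
qed

text \<open>Splitting off \<open>w powr (- \<delta>)\<close> trades part of the singularity at
  \<open>\<sigma> = 0\<close> for one at \<open>u = 0\<close>: \<open>\<delta> < q\<close> keeps the
  integral in \<open>u\<close> finite, and \<open>\<delta> > 0\<close> leaves a positive power of
  \<sigma>.\<close>

lemma F3_diag_bound:
  fixes e q \<sigma> \<delta> :: real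
  assumes \<sigma>: "0 < \<sigma>" "\<sigma> < 1" and \<delta>: "0 < \<delta>" "\<delta> < q" "\<delta> \<le> e"
  shows "\<sigma> powr e * F3_diag e q \<sigma> \<le> \<sigma> powr \<delta> * (1 / (q - \<delta>))"
proof -
  have "F3_diag e q \<sigma> \<le> (LBINT u:{0<..<1}. \<sigma> powr (\<delta> - e) * u powr ((q - \<delta>) - 1))"
    unfolding F3_diag_def
  proof (rule set_integral_mono)
    show "set_integrable lborel {0<..<1} (\<lambda>u. u powr (q - 1) * (u + \<sigma> * (1 - u)) powr (- e))"
      using \<sigma> \<delta> by (intro set_integrable_F3_diag) auto
    show "set_integrable lborel {0<..<1} (\<lambda>u. \<sigma> powr (\<delta> - e) * u powr ((q - \<delta>) - 1))"
      using \<delta> by (intro set_integrable_mult_right set_integrable_powr_01) auto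
    fix u :: real assume u: "u \<in> {0<..<1}"
    define w where "w = u + \<sigma> * (1 - u)"
    \<comment> \<open>The two forms of \<open>w\<close> give one lower bound each; as
      \<open>\<delta> \<le> e\<close>, both exponents \<open>\<delta> - e\<close> and
      \<open>- \<delta>\<close> used below are nonpositive.\<close>
    have "w = \<sigma> + u * (1 - \<sigma>)" by (simp add: w_def algebra_simps)
    moreover have "u * (1 - \<sigma>) \<ge> 0" "\<sigma> * (1 - u) \<ge> 0" using u \<sigma> by auto
    ultimately have w: "w \<ge> u" "w \<ge> \<sigma>" by (auto simp: w_def)
    have "w powr (- e) = w powr (\<delta> - e) * w powr (- \<delta>)"
      by (simp add: powr_add[symmetric])
    also have "\<dots> \<le> \<sigma> powr (\<delta> - e) * u powr (- \<delta>)"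
      using u \<sigma> w \<delta> by (intro mult_mono powr_mono2') auto
    finally have "u powr (q - 1) * w powr (- e) \<le> u powr (q - 1) * (\<sigma> powr (\<delta> - e) * u powr (- \<delta>))"
      by (intro mult_left_mono) auto
    also have "\<dots> = \<sigma> powr (\<delta> - e) * (u powr (q - 1) * u powr (- \<delta>))" by simp
    also have "u powr (q - 1) * u powr (- \<delta>) = u powr ((q - \<delta>) - 1)"
      by (simp add: powr_add[symmetric] algebra_simps)
    finally show "u powr (q - 1) * (u + \<sigma> * (1 - u)) powr (- e) \<le> \<sigma> powr (\<delta> - e) * u powr ((q - \<delta>) - 1)"
      by (simp add: w_def)
  qed
  also have "\<dots> = \<sigma> powr (\<delta> - e) * (LBINT u:{0<..<1}. u powr ((q - \<delta>) - 1) * (1 - u) powr (1 - 1))"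
    by (subst set_integral_mult_right[symmetric]) (auto intro!: set_lebesgue_integral_cong)
  also have "\<dots> = \<sigma> powr (\<delta> - e) * (1 / (q - \<delta>))"
    using \<delta> by (subst LBINT_Beta) (auto simp: Beta_one_right)
  finally have "\<sigma> powr e * F3_diag e q \<sigma> \<le> \<sigma> powr e * (\<sigma> powr (\<delta> - e) * (1 / (q - \<delta>)))"
    by (intro mult_left_mono) auto
  also have "\<dots> = (\<sigma> powr e * \<sigma> powr (\<delta> - e)) * (1 / (q - \<delta>))" by simp
  also have "\<sigma> powr e * \<sigma> powr (\<delta> - e) = \<sigma> powr \<delta>"
    by (simp add: powr_add[symmetric])
  finally show ?thesis .
qed

lemma kernel_profile_bound:
  fixes p q \<mu> \<sigma> \<delta> :: real
  assumes \<sigma>: "0 < \<sigma>" "\<sigma> < 1" and \<delta>: "0 < \<delta>" "\<delta> < q" "\<delta> \<le> p + \<mu>"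
  shows "\<bar>kernel_profile p q \<mu> (p + \<mu>) \<sigma>\<bar>
    \<le> (1 + \<bar>p - 1\<bar> * (1 / (q - \<delta>))) * (\<sigma> powr (\<delta> - 1) * (1 - \<sigma>) powr (q - 1))"
proof -
  define e where "e = p + \<mu>"
  \<comment> \<open>\<open>F3_diag_bound\<close> controls
    \<open>\<sigma> powr e * F3_diag e q \<sigma>\<close>, so a factor \<open>1 / \<sigma>\<close>
    is detached from the power in the profile.\<close>
  have shift: "\<sigma> powr (x - 1) = \<sigma> powr x * (1 / \<sigma>)" for x
    using \<sigma> by (simp add: powr_diff)
  have "\<bar>1 + (p - 1) * ((1 - \<sigma>) * F3_diag e q \<sigma>)\<bar> \<le> 1 + \<bar>p - 1\<bar> * (1 * F3_diag e q \<sigma>)"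
  proof -
    have "\<bar>(p - 1) * ((1 - \<sigma>) * F3_diag e q \<sigma>)\<bar> = \<bar>p - 1\<bar> * ((1 - \<sigma>) * F3_diag e q \<sigma>)"
      using \<sigma> F3_diag_nonneg[of e q \<sigma>] by (simp add: abs_mult)
    also have "\<dots> \<le> \<bar>p - 1\<bar> * (1 * F3_diag e q \<sigma>)"
      using \<sigma> F3_diag_nonneg[of e q \<sigma>] by (intro mult_left_mono mult_right_mono) auto
    finally show ?thesis by linarith
  qed
  then have "\<sigma> powr e * \<bar>1 + (p - 1) * ((1 - \<sigma>) * F3_diag e q \<sigma>)\<bar> \<le> \<sigma> powr e * (1 + \<bar>p - 1\<bar> * (1 * F3_diag e q \<sigma>))"
    by (intro mult_left_mono) auto
  also have "\<dots> = \<sigma> powr e + \<bar>p - 1\<bar> * (\<sigma> powr e * F3_diag e q \<sigma>)" by (simp add: algebra_simps)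
  also have "\<dots> \<le> \<sigma> powr \<delta> + \<bar>p - 1\<bar> * (\<sigma> powr \<delta> * (1 / (q - \<delta>)))"
    using \<sigma> \<delta> by (intro add_mono mult_left_mono F3_diag_bound powr_mono') (auto simp: e_def)
  finally have *: "\<sigma> powr e * \<bar>1 + (p - 1) * ((1 - \<sigma>) * F3_diag e q \<sigma>)\<bar>
      \<le> (1 + \<bar>p - 1\<bar> * (1 / (q - \<delta>))) * \<sigma> powr \<delta>" by (simp add: algebra_simps)
  have "\<bar>kernel_profile p q \<mu> (p + \<mu>) \<sigma>\<bar>
      = (\<sigma> powr e * \<bar>1 + (p - 1) * ((1 - \<sigma>) * F3_diag e q \<sigma>)\<bar>) * (1 / \<sigma> * (1 - \<sigma>) powr (q - 1))"
    using \<sigma> by (simp add: kernel_profile_def shift e_def abs_mult)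
  also have "\<dots> \<le> ((1 + \<bar>p - 1\<bar> * (1 / (q - \<delta>))) * \<sigma> powr \<delta>) * (1 / \<sigma> * (1 - \<sigma>) powr (q - 1))"
    using \<sigma> by (intro mult_right_mono *) auto
  also have "\<dots> = (1 + \<bar>p - 1\<bar> * (1 / (q - \<delta>))) * (\<sigma> powr (\<delta> - 1) * (1 - \<sigma>) powr (q - 1))"
    by (simp only: shift mult_ac)
  finally show ?thesis .
qed

lemma kernel_k_Lp:
  fixes a b \<mu> \<nu> :: real
  assumes a: "a > 0" and b: "b > 0" and e: "\<nu> / a + \<mu> > 0"
  shows "\<exists>\<epsilon>>0. set_integrable lborel {0<..<1} (\<lambda>s. \<bar>kernel_k a b \<mu> \<nu> 1 s\<bar> powr (1 + \<epsilon>))"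
proof -
  define p where "p = \<nu> / a"
  define q where "q = b / a"
  define \<delta> where "\<delta> = min q (p + \<mu>) / 2"
  \<comment> \<open>With \<open>\<epsilon> < a * \<delta>\<close> and \<open>\<epsilon> < q\<close>
    the exponents \<open>(a * \<delta> - 1) * (1 + \<epsilon>)\<close> at \<open>s = 0\<close> and
    \<open>(q - 1) * (1 + \<epsilon>)\<close> at \<open>s = 1\<close> both stay above -1.\<close>
  define \<epsilon> where "\<epsilon> = min q (a * \<delta>) / 2"
  have q: "q > 0" using a b by (simp add: q_def)
  have \<delta>: "0 < \<delta>" "\<delta> < q" "\<delta> \<le> p + \<mu>" using q e unfolding p_def[symmetric] by (auto simp: \<delta>_def min_def)
  have "a * \<delta> > 0" using a \<delta> by simp
  then have \<epsilon>: "0 < \<epsilon>" "\<epsilon> < q" "\<epsilon> < a * \<delta>" using q unfolding \<epsilon>_def by linarith+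
  define C where "C = 1 / Gamma q * a * (1 + \<bar>p - 1\<bar> * (1 / (q - \<delta>)))"
  have C: "C \<ge> 0" using a \<delta> Gamma_real_pos[OF q] unfolding C_def by (intro mult_nonneg_nonneg add_nonneg_nonneg) auto
  have bound: "\<bar>kernel_k a b \<mu> \<nu> 1 s\<bar> \<le> C * (s powr (a * \<delta> - 1) * (1 - s powr a) powr (q - 1))"
    if s: "s \<in> {0<..<1}" for s
  proof -
    define \<sigma> where "\<sigma> = s powr a"
    have \<sigma>: "0 < \<sigma>" "\<sigma> < 1" using s a powr_less_mono2[of a s 1] by (auto simp: \<sigma>_def)
    have "kernel_k a b \<mu> \<nu> 1 s = 1 / Gamma q * a * s powr (a - 1) * kernel_profile p q \<mu> (p + \<mu>) \<sigma>"
      using kernel_k_eq_profile[OF a b, of s \<mu> \<nu> 0] s by (simp add: p_def q_def \<sigma>_def)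
    then have "\<bar>kernel_k a b \<mu> \<nu> 1 s\<bar> = 1 / Gamma q * a * s powr (a - 1) * \<bar>kernel_profile p q \<mu> (p + \<mu>) \<sigma>\<bar>"
      using a Gamma_real_pos[OF q] by (simp add: abs_mult)
    also have "\<dots> \<le> 1 / Gamma q * a * s powr (a - 1) * ((1 + \<bar>p - 1\<bar> * (1 / (q - \<delta>))) * (\<sigma> powr (\<delta> - 1) * (1 - \<sigma>) powr (q - 1)))"
      using a Gamma_real_pos[OF q] by (intro mult_left_mono kernel_profile_bound \<sigma> \<delta>) auto
    also have "\<dots> = C * ((s powr (a - 1) * \<sigma> powr (\<delta> - 1)) * (1 - \<sigma>) powr (q - 1))"
      by (simp only: C_def mult_ac)
    also have "s powr (a - 1) * \<sigma> powr (\<delta> - 1) = s powr (a * \<delta> - 1)"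
      by (simp add: \<sigma>_def powr_powr powr_add[symmetric] algebra_simps)
    finally show ?thesis by (simp add: \<sigma>_def)
  qed
  \<comment> \<open>\<alpha> and \<beta> are the Beta parameters of the majorant in the variable
    \<open>s powr a\<close>; \<alpha> solves \<open>(a - 1) + a * (\<alpha> - 1) = (a * \<delta> -
    1) * (1 + \<epsilon>)\<close>, where \<open>a - 1\<close> belongs to the Jacobian.\<close>
  define \<alpha> where "\<alpha> = ((a * \<delta> - 1) * (1 + \<epsilon>) + 1) / a"
  define \<beta> where "\<beta> = (q - 1) * (1 + \<epsilon>) + 1"
  have \<alpha>: "\<alpha> > 0"
  proof -
    have "(a * \<delta> - 1) * (1 + \<epsilon>) + 1 = (a * \<delta> - \<epsilon>) + a * \<delta> * \<epsilon>" by (simp add: algebra_simps)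
    also have "\<dots> > 0" using \<epsilon> a \<delta> by (intro add_pos_pos mult_pos_pos) auto
    finally show ?thesis using a by (simp add: \<alpha>_def)
  qed
  have \<beta>: "\<beta> > 0"
  proof -
    have "\<beta> = (q - \<epsilon>) + q * \<epsilon>" by (simp add: \<beta>_def algebra_simps)
    also have "\<dots> > 0" using \<epsilon> q by (intro add_pos_pos mult_pos_pos) auto
    finally show ?thesis .
  qed
  have "set_integrable lborel {0<..<1} (\<lambda>s. (C powr (1 + \<epsilon>) / a) *
      (a * s powr (a - 1) * ((s powr a) powr (\<alpha> - 1) * (1 - s powr a) powr (\<beta> - 1))))"
    by (intro set_integrable_mult_right set_integrable_powr_substitution[OF a _ set_integrable_Beta[OF \<alpha> \<beta>]]) auto
  then have "set_integrable lborel {0<..<1} (\<lambda>s. \<bar>kernel_k a b \<mu> \<nu> 1 s\<bar> powr (1 + \<epsilon>))"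
  proof (rule set_integrable_bound)
    have "(\<lambda>s. \<bar>indicator {0<..<1} s *\<^sub>R kernel_k a b \<mu> \<nu> 1 s\<bar> powr (1 + \<epsilon>)) \<in> borel_measurable lborel"
      using set_borel_measurable_kernel_k[OF a b, of \<mu> \<nu>] unfolding set_borel_measurable_def by measurable
    also have "(\<lambda>s. \<bar>indicator {0<..<1} s *\<^sub>R kernel_k a b \<mu> \<nu> 1 s\<bar> powr (1 + \<epsilon>))
       = (\<lambda>s. indicator {0<..<1} s *\<^sub>R (\<bar>kernel_k a b \<mu> \<nu> 1 s\<bar> powr (1 + \<epsilon>)))"
      by (auto simp: indicator_def)
    finally show "set_borel_measurable lborel {0<..<1} (\<lambda>s. \<bar>kernel_k a b \<mu> \<nu> 1 s\<bar> powr (1 + \<epsilon>))"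
      unfolding set_borel_measurable_def .
    have dom: "\<bar>kernel_k a b \<mu> \<nu> 1 s\<bar> powr (1 + \<epsilon>) \<le> (C powr (1 + \<epsilon>) / a) *
      (a * s powr (a - 1) * ((s powr a) powr (\<alpha> - 1) * (1 - s powr a) powr (\<beta> - 1)))" if s: "s \<in> {0<..<1}" for s
    proof -
      have "\<bar>kernel_k a b \<mu> \<nu> 1 s\<bar> powr (1 + \<epsilon>) \<le> (C * (s powr (a * \<delta> - 1) * (1 - s powr a) powr (q - 1))) powr (1 + \<epsilon>)"
        using \<epsilon> by (intro powr_mono2 bound s) auto
      also have "\<dots> = C powr (1 + \<epsilon>) * (s powr ((a * \<delta> - 1) * (1 + \<epsilon>)) * (1 - s powr a) powr (\<beta> - 1))"
        using C by (simp add: powr_mult powr_powr \<beta>_def)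
      also have "(a * \<delta> - 1) * (1 + \<epsilon>) = (a - 1) + a * (\<alpha> - 1)"
        using a by (simp add: \<alpha>_def right_diff_distrib)
      also have "s powr \<dots> = s powr (a - 1) * (s powr a) powr (\<alpha> - 1)"
        by (simp add: powr_add powr_powr)
      finally show ?thesis using a by (simp add: mult_ac)
    qed
    show "AE s in lborel. s \<in> {0<..<1} \<longrightarrow> norm (\<bar>kernel_k a b \<mu> \<nu> 1 s\<bar> powr (1 + \<epsilon>)) \<le>
      norm ((C powr (1 + \<epsilon>) / a) * (a * s powr (a - 1) * ((s powr a) powr (\<alpha> - 1) * (1 - s powr a) powr (\<beta> - 1))))"
      by (intro AE_I2 impI, simp only: real_norm_def abs_of_nonneg[OF powr_ge_zero])
         (rule order_trans[OF dom abs_ge_self])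
  qed
  with \<epsilon> show ?thesis by blast
qed

section \<open>The Mittag-Leffler series\<close>

text \<open>The ratio is \<open>Beta (e + q * n) q / Gamma q\<close>, and the Beta integrals tend to
  0 by dominated convergence: \<open>(u powr q) ^ n\<close> tends to 0 for \<open>0 < u < 1\<close>,
  and the integrand for \<open>n = 0\<close> dominates.\<close>

lemma Gamma_ratio_tendsto_0:
  fixes e q :: real
  assumes e: "e > 0" and q: "q > 0"
  shows "(\<lambda>n. Gamma (e + q * real n) / Gamma (e + q * real (Suc n))) \<longlonglongrightarrow> 0"
proof -
  let ?I = "indicator {0<..<1} :: real \<Rightarrow> real"
  have A: "e + q * real n > 0" for n using e q by (intro add_pos_nonneg) auto
  have "(\<lambda>n. LINT u|lborel. ?I u *\<^sub>R (u powr (e + q * real n - 1) * (1 - u) powr (q - 1))) \<longlonglongrightarrow> (LINT u::real|lborel. 0)"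
  proof (rule integral_dominated_convergence)
    show "integrable lborel (\<lambda>u. ?I u *\<^sub>R (u powr (e - 1) * (1 - u) powr (q - 1)))"
      using set_integrable_Beta[OF e q] by (simp add: set_integrable_def)
    show "AE u in lborel. (\<lambda>n. ?I u *\<^sub>R (u powr (e + q * real n - 1) * (1 - u) powr (q - 1))) \<longlonglongrightarrow> 0"
    proof (intro AE_I2)
      fix u :: real
      show "(\<lambda>n. ?I u *\<^sub>R (u powr (e + q * real n - 1) * (1 - u) powr (q - 1))) \<longlonglongrightarrow> 0"
      proof (cases "u \<in> {0<..<1}")
        case True
        have "u powr q < 1" using True q powr_less_mono2[of q u 1] by simp
        then have "(\<lambda>n. u powr (e - 1) * (1 - u) powr (q - 1) * (u powr q) ^ n) \<longlonglongrightarrow> u powr (e - 1) * (1 - u) powr (q - 1) * 0"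
          by (intro tendsto_intros LIMSEQ_power_zero) auto
        moreover have "u powr (e - 1) * (1 - u) powr (q - 1) * (u powr q) ^ n = u powr (e + q * real n - 1) * (1 - u) powr (q - 1)" for n
        proof -
          have "(u powr q) ^ n = u powr (q * real n)"
            using True by (simp add: powr_realpow[symmetric] powr_powr)
          then have "u powr (e - 1) * (u powr q) ^ n = u powr (e + q * real n - 1)"
            by (simp add: powr_add[symmetric] algebra_simps)
          then show ?thesis by (metis mult.assoc mult.commute)
        qed
        ultimately show ?thesis using True by simp
      qed simp
    qed
    show "AE u in lborel. norm (?I u *\<^sub>R (u powr (e + q * real n - 1) * (1 - u) powr (q - 1)))
        \<le> ?I u *\<^sub>R (u powr (e - 1) * (1 - u) powr (q - 1))" for n
      using q by (auto simp: indicator_def intro!: AE_I2 mult_right_mono powr_mono')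
  qed auto
  then have "(\<lambda>n. Beta (e + q * real n) q) \<longlonglongrightarrow> 0"
    using LBINT_Beta[OF A q] by (simp add: set_lebesgue_integral_def)
  then have "(\<lambda>n. Beta (e + q * real n) q / Gamma q) \<longlonglongrightarrow> 0 / Gamma q"
    using Gamma_real_pos[OF q] by (intro tendsto_divide tendsto_const) auto
  moreover have "Beta (e + q * real n) q / Gamma q = Gamma (e + q * real n) / Gamma (e + q * real (Suc n))" for n
    using Gamma_real_pos[OF q] by (simp add: Beta_def algebra_simps)
  ultimately show ?thesis by simp
qed

text \<open>Ratio test: successive terms differ by the factor \<open>J n * z\<close>, whose modulus
  is eventually below \<open>1 / 2\<close> for every \<open>z\<close>.\<close>

lemma summable_powser_ratio_0:
  fixes c J :: "nat \<Rightarrow> real" and z :: complex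
  assumes step: "\<And>n. c (Suc n) = c n * J n" and J: "J \<longlonglongrightarrow> 0"
  shows "summable (\<lambda>n. complex_of_real (c n) * z ^ n)"
proof -
  have "(\<lambda>n. \<bar>J n\<bar> * norm z) \<longlonglongrightarrow> \<bar>0\<bar> * norm z"
    using J by (intro tendsto_intros)
  then have "eventually (\<lambda>n. \<bar>J n\<bar> * norm z < 1 / 2) sequentially"
    by (intro order_tendstoD(2)) auto
  then obtain N where N: "\<And>n. n \<ge> N \<Longrightarrow> \<bar>J n\<bar> * norm z < 1 / 2"
    by (auto simp: eventually_sequentially)
  show ?thesis
  proof (rule summable_ratio_test[of "1 / 2" N])
    fix n assume "n \<ge> N"
    have "norm (complex_of_real (c (Suc n)) * z ^ Suc n) = (\<bar>J n\<bar> * norm z) * norm (complex_of_real (c n) * z ^ n)"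
      by (simp add: step norm_mult norm_power abs_mult)
    also have "\<dots> \<le> 1 / 2 * norm (complex_of_real (c n) * z ^ n)"
      using N[OF \<open>n \<ge> N\<close>] by (intro mult_right_mono) auto
    finally show "norm (complex_of_real (c (Suc n)) * z ^ Suc n) \<le> 1 / 2 * norm (complex_of_real (c n) * z ^ n)" .
  qed simp
qed

theorem theorem4p1:
  fixes a b \<mu> \<nu> :: real and c :: "nat \<Rightarrow> real"
  assumes "b > 0" and "a > 0" and "\<mu> > -1" and "\<nu> > max (-b) (-a * \<mu>)"
    and "c 0 = 1"
    and "\<And>n. c (Suc n) = c n * (LBINT s:{0<..<1}. kernel_k a b \<mu> \<nu> 1 s * s powr (b * real n))"
  shows "(\<forall>t s. t > 0 \<and> 0 < s \<and> s < 1 \<longrightarrow>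
            kernel_k a b \<mu> \<nu> t (t * s) = t powr (b - 1) * kernel_k a b \<mu> \<nu> 1 s)
    \<and> (\<exists>\<epsilon>>0. set_borel_measurable lborel {0<..<1} (kernel_k a b \<mu> \<nu> 1)
              \<and> set_integrable lborel {0<..<1} (\<lambda>s. \<bar>kernel_k a b \<mu> \<nu> 1 s\<bar> powr (1 + \<epsilon>)))
    \<and> (\<forall>z::complex. (\<lambda>n. complex_of_real (c n) * z ^ n) sums
          (complex_of_real (Gamma (\<nu> / a + \<mu>))
           * mittag_leffler3 (of_real (b / a)) (of_real (\<nu> / a + \<mu>)) (of_real (1 + (\<nu> - a) / b)) z))"
proof (intro conjI allI impI)
  define e where "e = \<nu> / a + \<mu>"
  define q where "q = b / a"
  define l where "l = 1 + (\<nu> - a) / b"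
  define J where "J n = Gamma (e + q * real n) / Gamma (e + q * real (Suc n)) * ((l + real n) / real (Suc n))" for n
  have q: "q > 0" using assms(1,2) by (simp add: q_def)
  have "\<nu> + a * \<mu> > 0" using assms(4) by simp
  then have e: "e > 0" using assms(2) by (simp add: e_def field_simps)
  have pos: "Gamma (e + q * real n) > 0" for n
    using e q by (intro Gamma_real_pos add_pos_nonneg) auto
  show "kernel_k a b \<mu> \<nu> t (t * s) = t powr (b - 1) * kernel_k a b \<mu> \<nu> 1 s"
    if "t > 0 \<and> 0 < s \<and> s < 1" for t s
    using that assms(2) by (intro kernel_k_homogeneous) auto
  show "\<exists>\<epsilon>>0. set_borel_measurable lborel {0<..<1} (kernel_k a b \<mu> \<nu> 1)
              \<and> set_integrable lborel {0<..<1} (\<lambda>s. \<bar>kernel_k a b \<mu> \<nu> 1 s\<bar> powr (1 + \<epsilon>))"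
    using kernel_k_Lp[OF assms(2,1), of \<nu> \<mu>] set_borel_measurable_kernel_k[OF assms(2,1), of \<mu> \<nu>] e
    by (auto simp: e_def)
  have step: "c (Suc n) = c n * J n" for n
    using assms(6)[of n] kernel_k_moment[OF assms(2,1), of \<nu> \<mu> n] e by (simp only: J_def e_def q_def l_def)
  \<comment> \<open>In the product of the moments the Gamma quotients telescope, while the factors
    \<open>l + n\<close> and \<open>n + 1\<close> build up the Pochhammer symbol and the
    factorial.\<close>
  have c: "c n = Gamma e * (pochhammer l n / (Gamma (e + q * real n) * fact n))" for n
  proof (induction n)
    case 0
    then show ?case using assms(5) pos[of 0] by simp
  next
    case (Suc n)
    then show ?case
      unfolding step J_def using pos[of n] by (simp add: pochhammer_Suc del: of_nat_Suc)
  qed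
  have J: "J \<longlonglongrightarrow> 0"
  proof -
    have "(\<lambda>n. (l + real n) / real (Suc n)) \<longlonglongrightarrow> 1" by real_asymp
    from tendsto_mult[OF Gamma_ratio_tendsto_0[OF e q] this] show ?thesis
      by (simp add: J_def[abs_def])
  qed
  fix z :: complex
  let ?t = "\<lambda>n. pochhammer (of_real l) n / (Gamma (of_real q * of_nat n + of_real e) * fact n) * z ^ n :: complex"
  have t: "complex_of_real (c n) * z ^ n = of_real (Gamma e) * ?t n" for n
  proof -
    have "Gamma (of_real q * of_nat n + of_real e) = complex_of_real (Gamma (e + q * real n))"
      by (simp flip: Gamma_complex_of_real add: add.commute)
    then show ?thesis
      by (simp add: c pochhammer_of_real)
  qed
  \<comment> \<open>\<open>mittag_leffler3\<close> is a \<open>suminf\<close>, so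
    \<open>sums\<close> needs a separate proof of convergence; division by the nonzero
    \<open>Gamma e\<close> carries it over from the coefficients \<open>c n\<close>.\<close>
  have "summable (\<lambda>n. of_real (Gamma e) * ?t n)"
    using summable_powser_ratio_0[OF step J, of z] by (simp only: t)
  moreover have "complex_of_real (Gamma e) \<noteq> 0" using pos[of 0] by simp
  ultimately have "summable ?t" by (simp only: summable_cmult_iff simp_thms)
  then have "(\<lambda>n. of_real (Gamma e) * ?t n) sums (of_real (Gamma e) * suminf ?t)"
    by (intro sums_mult summable_sums)
  then show "(\<lambda>n. complex_of_real (c n) * z ^ n) sums
          (complex_of_real (Gamma (\<nu> / a + \<mu>))
           * mittag_leffler3 (of_real (b / a)) (of_real (\<nu> / a + \<mu>)) (of_real (1 + (\<nu> - a) / b)) z)"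
    by (simp only: t mittag_leffler3_def flip: e_def q_def l_def)
qed

end
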